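(* Let $\mathcal V:\bar{\mathcal L}^{\dag}\to\bar{\mathcal L}$, $A^{\dag}_\gamma\in\mathrm{Aut}_{\mathrm{Lie}}\bar{\mathcal L}^{\dag}$ ($\gamma\in\mathbb Z/p$) and the derivation $B^{\dag}$ of $\bar{\mathcal L}^{\dag}$ with $A^{\dag}_\gamma=\widetilde{\exp}(\gamma B^{\dag})$ be as in the context. Suppose $\mathcal I$ is an ideal in $\bar{\mathcal L}$. Then the following conditions are equivalent: a) for any $\gamma\in\mathbb Z/p$, $A^{\dag}_\gamma(\mathrm{Ker}\,\mathcal V)\subset\mathcal V^{-1}(\mathcal I)$; b) $B^{\dag}(\mathrm{Ker}\,\mathcal V)\subset\mathcal V^{-1}(\mathcal I)$.
   Context: **Notation.** $p$ is a prime, $v_0>0$, $k\simeq\mathbb F_{p^{N_0}}$, $\mathcal K=k((t))$, $\sigma$ the $p$-th power map, $\alpha_0\in k$ fixed with $\mathrm{Tr}_{k/\mathbb F_p}\alpha_0=1$. $\mathbb Z^+(p)=\{a\in\mathbb N:\gcd(a,p)=1\}$, $\mathbb Z^0(p)=\mathbb Z^+(p)\cup\{0\}$. For an $\mathbb F_p$-module $M$, $M_B=M\hat\otimes_{\mathbb F_p}B$; $\sigma$ acts on $M_{\mathcal K}$ through $\mathcal K$. $C_s(L)$ is the closed ideal of a Lie algebra $L$ generated by commutators of degree $\ge s$; $\circ$ is the Campbell–Hausdorff law on a Lie algebra of nilpotent class $<p$; $\widetilde{\exp}(x)=\sum_{0\le i<p}x^i/i!$. **$\bar{\mathcal L}$.**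 $\widetilde{\mathcal L}$ is the profinite free Lie $\mathbb F_p$-algebra with topological module of generators $\mathcal K^*/\mathcal K^{*p}$, $\mathcal L=\widetilde{\mathcal L}/C_p(\widetilde{\mathcal L})$. Via $(\mathcal K^*/\mathcal K^{*p})\hat\otimes k=\mathrm{Hom}_{\mathbb F_p}(\mathcal K/(\sigma-\mathrm{id})\mathcal K,k)=\mathrm{Hom}_{\mathbb F_p}(\bigoplus_{a\in\mathbb Z^+(p)}kt^{-a}\oplus\mathbb F_p\alpha_0,k)$, $\mathcal L_k$ has topological free generators $D_0$ and $D_{an}$ ($a\in\mathbb Z^+(p)$, $n\in\mathbb Z/N_0$), $D_{an}(\alpha t^{-b})=\delta_{ab}\sigma^n(\alpha)$, $D_0$ corresponding to $t\otimes1$; $D_{0n}=\sigma^n(\alpha_0)D_0$. $\mathrm{wt}(D_{an})=s$ if $(s-1)v_0\le a<sv_0$; $\mathcal L(s)_k$ is generated by commutators of total weight $\ge s$; $\bar{\mathcal L}=\mathcal L/\mathcal L(p)$. **Parameters.** $u^*=(p-1)(p-2)+1$, $w^*=(p-1)v_0$. For $1\le s<p$, $\delta_0(s)$ is the minimum of the positive values of $v_0-\frac1s(a_1+a_2p^{-n_2}+\dots+a_up^{-n_u})$ with $u\le u^*$, $n_i\in\mathbb Z_{\ge0}$, $a_i\in[0,w^* )\cap\mathbb Z$; $\delta_0=\min_s\delta_0(s)$. Fix $r^*=b_0^*/(q_0^*-1)\in(v_0-\delta_0,v_0)$ with $q_0^*=p^{N_0^*}$, $N_0^*\ge2$, $b_0^*\in\mathbb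 N$, $\gcd(b_0^*,p(q_0^*-1))=1$. For $1\le u\le u^*$: $A[u]$ is the set of $a_1p^{-n_1}+\dots+a_up^{-n_u}$ with $0=n_1\le\dots\le n_u$, $a_i\in[0,w^* )\cap\mathbb Z$, and $A[u,M]$ is the subset where $n_u\le M$; $B[u]$ is the set of $r^*(b_1p^{-m_1}+\dots+b_up^{-m_u})$ with $0=m_1\le\dots\le m_u$, $b_i\in\mathbb Z_{\ge0}$, $b_1\ne0$, $b_1+\dots+b_u<p$, and $B[u,M]$ the subset where $m_u\le M$. For sets, $\rho(A,B)=\inf|\alpha-\beta|$. Fix $N^*\in\mathbb N$ with $N^*\equiv0$ mod $N_0$ and mod $N_0^*$, $p^{N^*}\rho(A[u^*],B[u^*])\ge2r^*(p-1)$ and $r^*(1-p^{-N^*})\in(v_0-\delta_0,v_0)$. Put $q=p^{N^*}$, $b^*=r^*(q-1)\in\mathbb N$. **Index sets.** $\mathfrak A^0$ is the set of $\iota=p^m(q\alpha-(q-1)\beta)$ with $m\in\mathbb Z_{\ge0}$, $\alpha\in A[u^*,m]$, $\beta\in B[u^*,m]\cup\{0\}$, $|\iota|\le b^*(p-1)$. The integers $p^m\alpha$ and $p^m\beta/r^*$ depend only on $\iota$. If $\beta\ne0$ and $\beta/r^*=b_1+b_2p^{-m_2}+\dots+b_up^{-m_u}$ with $u\le u^*$, $0\le m_2\le\dots\le m_u\le m$, $b_i\in\mathbb Z_{\ge0}$, $b_1\ne0$, $b_1+\dots+b_u<p$, then $\mathrm{ch}(\iota):=b_1+\dots+b_u$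 (and $\mathrm{ch}(\iota):=0$ if $\beta=0$); it depends only on $\iota$. $\kappa(\iota)$ is the minimal $u$ for which $p^m\alpha=a_1p^{n_1}+\dots+a_up^{n_u}$ with $a_i\in[0,(p-1)v_0)\cap\mathbb Z$, $n_1=m$, $0\le n_i\le m$. $w^0(\iota)$ is the minimal positive integer with $\iota<w^0(\iota)b^*$. $\mathfrak A^+(p)$ is the set of $\iota\in\mathfrak A^0$ with $\iota>0$, $\gcd(p^m\alpha,p^m\beta/r^*,p)=1$, $w^0(\iota)+\mathrm{ch}(\iota)\le p-1$, $\kappa(\iota)\le(p-2)\mathrm{ch}(\iota)+w^0(\iota)$. $\mathfrak A^0(p)=\mathfrak A^+(p)\cup\{0\}$. The elements of $\mathfrak A^0(p)$ with $\mathrm{ch}=0$ are the $qa$ with $a\in\mathbb Z^0(p)\cap[0,(p-1)v_0)$. **The algebra $\bar{\mathcal L}^{\dag}$.** $\widetilde{\mathcal L}^{\dag}_k$ is the free Lie $k$-algebra on $D_0^{\dag}$ and $D^{\dag}_{\iota n}$ ($\iota\in\mathfrak A^+(p)$, $n\in\mathbb Z/N_0$); $D^{\dag}_{0n}=\sigma^n(\alpha_0)D_0^{\dag}$; $\sigma$ is its $\sigma$-linear automorphism with $D^{\dag}_{\iota n}\mapsto D^{\dag}_{\iota,n+1}$; $\widetilde{\mathcal L}^{\dag}$ is the $\mathbb F_p$-algebra of $\sigma$-invariants; $\mathcal L^{\dag}=\widetilde{\mathcal L}^{\dag}/C_p(\widetilde{\mathcal L}^{\dag})$. $\mathcal L^{\dag}(s)_k$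 is generated over $k$ by commutators of $D^{\dag}_{\iota_1n_1},\dots,D^{\dag}_{\iota_rn_r}$ with $\sum w^0(\iota_i)\ge s$; $\mathcal L^{\dag}=\bigoplus_{m\ge0}\mathcal L^{\dag}[m]$ is the grading in which $D^{\dag}_{\iota n}$ has degree $\mathrm{ch}(\iota)$; $\mathcal L^{\dag}(s)[m]=\mathcal L^{\dag}(s)\cap\mathcal L^{\dag}[m]$. $\bar{\mathcal L}^{\dag}=\mathcal L^{\dag}/\sum_{s+m\ge p}\mathcal L^{\dag}(s)[m]$, with induced $\bar{\mathcal L}^{\dag}(s)$, $\bar{\mathcal L}^{\dag}[m]$, $\bar{\mathcal L}^{\dag}(s)[m]$. $\bar{\mathcal N}^{\dag}\subset\bar{\mathcal L}^{\dag}_{\mathcal K}$ is the $k$-subalgebra (topologically) generated as a $k$-module by $t^{-b}l$ with $l\in\bar{\mathcal L}^{\dag}(s)[m]_k$, $b<(s+m)b^*$; $\widetilde{\mathcal N}^{\dag}=\bar{\mathcal N}^{\dag}/t^{(p-1)b^*}\bar{\mathcal N}^{\dag}$. $\widetilde{\mathcal N}^{sp}\subset\widetilde{\mathcal N}^{\dag}$ is the $k$-submodule generated by $t^{-\iota}l$ with $\iota\in\mathfrak A^0$, $l\in\bar{\mathcal L}^{\dag}(s)[m]_k$, $\iota+\mathrm{ch}(\iota)b^*<(s+m)b^*$, $\mathrm{ch}(\iota)\ge m$, $\kappa(\iota)\le(p-2)m+s$; it is a Lie subalgebra. $\widetilde{\mathcal N}^{sp}\langle1\rangle$ is generated by those generators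 with $\mathrm{ch}(\iota)\ge m+1$. **$A^{\dag}_\gamma$, $B^{\dag}$, $\mathcal V$.** Fix $\bar e^{sp}\in\bar{\mathcal N}^{\dag}$ with $\bar e^{sp}\equiv\sum_{\iota\in\mathfrak A^0(p)}t^{-\iota}D^{\dag}_{\iota0}$ mod $C_2(\bar{\mathcal L}^{\dag}_{\mathcal K})$ and $\tilde e^{sp}:=\bar e^{sp}$ mod $t^{(p-1)b^*}\bar{\mathcal N}^{\dag}\in\widetilde{\mathcal N}^{sp}$. For $\gamma\in\mathbb Z/p$ and $\iota=p^n(q\alpha-(q-1)\beta)\in\mathfrak A^0$ with $t^{-\iota}l\in\widetilde{\mathcal N}^{sp}$, $\Omega_\gamma(t^{-\iota}l)=t^{-\iota}\widetilde{\exp}(\gamma(p^n\alpha)t^{b^*})l$, extended additively. There are unique $\tilde c_\gamma\in\widetilde{\mathcal N}^{sp}\langle1\rangle$ and $A^{\dag}_\gamma\in\mathrm{Aut}_{\mathrm{Lie}}\bar{\mathcal L}^{\dag}$ with $\sigma\tilde c_\gamma\in\widetilde{\mathcal N}^{sp}\langle1\rangle$, $\Omega_\gamma(\tilde e^{sp})=(\sigma\tilde c_\gamma)\circ(A^{\dag}_\gamma\otimes\mathrm{id}_{\mathcal K})\tilde e^{sp}\circ(-\tilde c_\gamma)$, and $A^{\dag}_\gamma(D^{\dag}_{\iota0})-D^{\dag}_{\iota0}\in\bigoplus_{m<\mathrm{ch}(\iota)}\bar{\mathcal L}^{\dag}[m]_k$ for all $\iota\in\mathfrak A^0(p)$. One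 has $A^{\dag}_{\gamma+\gamma_1}=A^{\dag}_\gamma A^{\dag}_{\gamma_1}$ and $(A^{\dag}_\gamma-\mathrm{id})(\bar{\mathcal L}^{\dag}[m])\subset\bigoplus_{m'<m}\bar{\mathcal L}^{\dag}[m']$, and $B^{\dag}$ is the derivation of the Lie algebra $\bar{\mathcal L}^{\dag}$ with $B^{\dag}(\bar{\mathcal L}^{\dag}[m])\subset\bigoplus_{m'<m}\bar{\mathcal L}^{\dag}[m']$ for all $m\ge0$ and $A^{\dag}_\gamma=\widetilde{\exp}(\gamma B^{\dag})$ for all $\gamma\in\mathbb Z/p$. $\mathcal V:\bar{\mathcal L}^{\dag}\to\bar{\mathcal L}$ is the epimorphism of Lie algebras with $D^{\dag}_{qa,n}\mapsto D_{an}$ for $qa\in\mathfrak A^0(p)$, $\mathrm{ch}(qa)=0$, and $D^{\dag}_{\iota n}\mapsto0$ if $\mathrm{ch}(\iota)\ge1$; it restricts to an isomorphism $\bar{\mathcal L}^{\dag}[0]\simeq\bar{\mathcal L}$. *)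

theory Defs
  imports Complex_Main
    "HOL-Library.Function_Algebras"
    "HOL-Computational_Algebra.Formal_Laurent_Series"
    "HOL-Analysis.Elementary_Topology"
begin

unbundle fps_syntax

section \<open>Parameters\<close>

text \<open>The finite field \<open>k\<close> is the type \<open>'k\<close>; its \<open>p\<close>-th power map is \<open>\<lambda>x. x ^ p\<close>.\<close>

record 'k params =
  chr :: nat            \<comment> \<open>\<open>p\<close>\<close>
  N0 :: nat
  v0 :: real
  alpha0 :: 'k
  N0s :: nat            \<comment> \<open>\<open>N\<^sub>0\<^sup>*\<close>\<close>
  b0s :: nat            \<comment> \<open>\<open>b\<^sub>0\<^sup>*\<close>\<close>
  Ns :: nat             \<comment> \<open>\<open>N\<^sup>*\<close>\<close>

definition ustar :: "'k params \<Rightarrow> nat" where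
  "ustar P = (chr P - 1) * (chr P - 2) + 1"

definition wstar :: "'k params \<Rightarrow> real" where
  "wstar P = (real (chr P) - 1) * v0 P"

definition rstar :: "'k params \<Rightarrow> real" where
  "rstar P = real (b0s P) / (real (chr P ^ N0s P) - 1)"

definition qq :: "'k params \<Rightarrow> nat" where
  "qq P = chr P ^ Ns P"

text \<open>\<open>b\<^sup>* = r\<^sup>* (q - 1)\<close> is an integer because \<open>N\<^sub>0\<^sup>*\<close> divides \<open>N\<^sup>*\<close>;
  the floor only changes the type.\<close>
definition bstar :: "'k params \<Rightarrow> int" where
  "bstar P = \<lfloor>rstar P * (real (qq P) - 1)\<rfloor>"

definition delta0_at :: "'k params \<Rightarrow> nat \<Rightarrow> real" where
  "delta0_at P s = (LEAST d. 0 < d \<and>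
     (\<exists>u (a :: nat \<Rightarrow> nat) (n :: nat \<Rightarrow> nat). 1 \<le> u \<and> u \<le> ustar P \<and> n 1 = 0 \<and>
        (\<forall>i\<in>{1..u}. real (a i) < wstar P) \<and>
        d = v0 P - (1 / real s) * (\<Sum>i=1..u. real (a i) / real (chr P) ^ n i)))"

definition delta0 :: "'k params \<Rightarrow> real" where
  "delta0 P = Min (delta0_at P ` {1..<chr P})"

text \<open>\<open>A[u,M]\<close> and \<open>B[u,M]\<close>; the sets \<open>A[u]\<close> and \<open>B[u]\<close> are the unions over all \<open>M\<close>.\<close>

definition setA_upto :: "'k params \<Rightarrow> nat \<Rightarrow> nat \<Rightarrow> real set" where
  "setA_upto P u M = {x. \<exists>(a :: nat \<Rightarrow> nat) (n :: nat \<Rightarrow> nat).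
     n 1 = 0 \<and> mono_on {1..u} n \<and> n u \<le> M \<and> (\<forall>i\<in>{1..u}. real (a i) < wstar P) \<and>
     x = (\<Sum>i=1..u. real (a i) / real (chr P) ^ n i)}"

definition setA :: "'k params \<Rightarrow> nat \<Rightarrow> real set" where
  "setA P u = (\<Union>M. setA_upto P u M)"

definition B_digits :: "'k params \<Rightarrow> nat \<Rightarrow> (nat \<Rightarrow> nat) \<Rightarrow> (nat \<Rightarrow> nat) \<Rightarrow> bool" where
  "B_digits P u b m \<longleftrightarrow>
     m 1 = 0 \<and> mono_on {1..u} m \<and> b 1 \<noteq> 0 \<and> (\<Sum>i=1..u. b i) < chr P"

definition B_value :: "'k params \<Rightarrow> nat \<Rightarrow> (nat \<Rightarrow> nat) \<Rightarrow> (nat \<Rightarrow> nat) \<Rightarrow> real" where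
  "B_value P u b m = (\<Sum>i=1..u. real (b i) / real (chr P) ^ m i)"

definition setB_upto :: "'k params \<Rightarrow> nat \<Rightarrow> nat \<Rightarrow> real set" where
  "setB_upto P u M =
     {rstar P * B_value P u b m | b m. B_digits P u b m \<and> m u \<le> M}"

definition setB :: "'k params \<Rightarrow> nat \<Rightarrow> real set" where
  "setB P u = (\<Union>M. setB_upto P u M)"

definition rho :: "real set \<Rightarrow> real set \<Rightarrow> real" where
  "rho X Y = (INF (\<alpha>, \<beta>)\<in>X \<times> Y. \<bar>\<alpha> - \<beta>\<bar>)"

definition admissible :: "'k::{field,finite} params \<Rightarrow> bool" where
  "admissible P \<longleftrightarrow>
     prime (chr P) \<and> 0 < v0 P \<and> card (UNIV :: 'k set) = chr P ^ N0 P \<and>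
     (\<Sum>i<N0 P. alpha0 P ^ (chr P ^ i)) = 1 \<and>
     2 \<le> N0s P \<and> coprime (b0s P) (chr P * (chr P ^ N0s P - 1)) \<and>
     rstar P \<in> {v0 P - delta0 P <..< v0 P} \<and>
     N0 P dvd Ns P \<and> N0s P dvd Ns P \<and>
     real (qq P) * rho (setA P (ustar P)) (setB P (ustar P)) \<ge> 2 * rstar P * (real (chr P) - 1) \<and>
     rstar P * (1 - 1 / real (qq P)) \<in> {v0 P - delta0 P <..< v0 P}"


section \<open>Index sets\<close>

text \<open>\<open>iota_rep P \<iota> m x y\<close>: \<open>\<iota> = p\<^sup>m (q \<alpha> - (q - 1) \<beta>)\<close> belongs to the set \<open>\<AA>\<^sup>0\<close>,
  with \<open>x = p\<^sup>m \<alpha>\<close> and \<open>y = p\<^sup>m \<beta> / r\<^sup>*\<close>.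
  All such \<open>\<iota>\<close> are integers, since \<open>b\<^sup>*\<close>, \<open>x\<close> and \<open>y\<close> are.\<close>
definition iota_rep :: "'k params \<Rightarrow> int \<Rightarrow> nat \<Rightarrow> int \<Rightarrow> int \<Rightarrow> bool" where
  "iota_rep P \<iota> m x y \<longleftrightarrow>
     (\<exists>\<alpha>\<in>setA_upto P (ustar P) m. \<exists>\<beta>\<in>setB_upto P (ustar P) m \<union> {0}.
        real_of_int \<iota> = real (chr P) ^ m * (real (qq P) * \<alpha> - (real (qq P) - 1) * \<beta>) \<and>
        \<bar>\<iota>\<bar> \<le> bstar P * (int (chr P) - 1) \<and>
        real_of_int x = real (chr P) ^ m * \<alpha> \<and>
        real_of_int y = real (chr P) ^ m * \<beta> / rstar P)"

definition A0 :: "'k params \<Rightarrow> int set" where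
  "A0 P = {\<iota>. \<exists>m x y. iota_rep P \<iota> m x y}"

definition alpha_part :: "'k params \<Rightarrow> int \<Rightarrow> int" where
  "alpha_part P \<iota> = (THE x. \<exists>m y. iota_rep P \<iota> m x y)"

definition beta_part :: "'k params \<Rightarrow> int \<Rightarrow> int" where
  "beta_part P \<iota> = (THE y. \<exists>m x. iota_rep P \<iota> m x y)"

definition ch :: "'k params \<Rightarrow> int \<Rightarrow> nat" where
  "ch P \<iota> = (THE c. \<exists>m x y. iota_rep P \<iota> m x y \<and>
     (if y = 0 then c = 0
      else \<exists>u\<in>{1..ustar P}. \<exists>b ms. B_digits P u b ms \<and> ms u \<le> m \<and>
             real_of_int y / real (chr P) ^ m = B_value P u b ms \<and> c = (\<Sum>i=1..u. b i)))"

text \<open>The exponent \<open>m\<close> is not determined by \<open>\<iota>\<close> when \<open>\<beta> = 0\<close>;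
  the minimum runs over all admissible \<open>m\<close>.\<close>
definition kappa :: "'k params \<Rightarrow> int \<Rightarrow> nat" where
  "kappa P \<iota> = (LEAST u. 1 \<le> u \<and>
     (\<exists>m x y (a :: nat \<Rightarrow> nat) (n :: nat \<Rightarrow> nat). iota_rep P \<iota> m x y \<and>
        x = int (\<Sum>i=1..u. a i * chr P ^ n i) \<and> n 1 = m \<and>
        (\<forall>i\<in>{1..u}. n i \<le> m \<and> real (a i) < (real (chr P) - 1) * v0 P)))"

definition w0 :: "'k params \<Rightarrow> int \<Rightarrow> nat" where
  "w0 P \<iota> = (LEAST w. 0 < w \<and> \<iota> < int w * bstar P)"

definition Aplus :: "'k params \<Rightarrow> int set" where
  "Aplus P = {\<iota> \<in> A0 P. 0 < \<iota> \<and>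
     gcd (gcd (alpha_part P \<iota>) (beta_part P \<iota>)) (int (chr P)) = 1 \<and>
     w0 P \<iota> + ch P \<iota> \<le> chr P - 1 \<and>
     kappa P \<iota> \<le> (chr P - 2) * ch P \<iota> + w0 P \<iota>}"

definition A0p :: "'k params \<Rightarrow> int set" where
  "A0p P = insert 0 (Aplus P)"

definition Zplus :: "'k params \<Rightarrow> int set" where
  "Zplus P = {a. 0 < a \<and> coprime a (int (chr P))}"

definition wt :: "'k params \<Rightarrow> int \<Rightarrow> nat" where
  "wt P a = (THE s. (real s - 1) * v0 P \<le> real_of_int a \<and> real_of_int a < real s * v0 P)"


section \<open>Commutators and ideals\<close>

text \<open>If \<open>W\<close> assigns degrees to some elements, then \<open>(x, d) \<in> comm br W\<close> means that \<open>x\<close>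
  is an iterated commutator, with any bracketing, of elements of total degree \<open>d\<close>.\<close>
inductive_set comm :: "('a \<Rightarrow> 'a \<Rightarrow> 'a) \<Rightarrow> ('a \<times> nat) set \<Rightarrow> ('a \<times> nat) set"
  for br :: "'a \<Rightarrow> 'a \<Rightarrow> 'a" and W :: "('a \<times> nat) set" where
  base: "(x, d) \<in> W \<Longrightarrow> (x, d) \<in> comm br W"
| brak: "(x, d) \<in> comm br W \<Longrightarrow> (y, e) \<in> comm br W \<Longrightarrow> (br x y, d + e) \<in> comm br W"

definition comm_ge :: "('a \<Rightarrow> 'a \<Rightarrow> 'a) \<Rightarrow> ('a \<times> nat) set \<Rightarrow> nat \<Rightarrow> 'a set" where
  "comm_ge br W s = {x. \<exists>d\<ge>s. (x, d) \<in> comm br W}"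

definition comm_eq :: "('a \<Rightarrow> 'a \<Rightarrow> 'a) \<Rightarrow> ('a \<times> nat) set \<Rightarrow> nat \<Rightarrow> 'a set" where
  "comm_eq br W d = {x. (x, d) \<in> comm br W}"

definition is_ideal ::
  "('k::field \<Rightarrow> 'a::ab_group_add \<Rightarrow> 'a) \<Rightarrow> ('a \<Rightarrow> 'a \<Rightarrow> 'a) \<Rightarrow> 'a set \<Rightarrow> 'a set \<Rightarrow> bool" where
  "is_ideal sc br C I \<longleftrightarrow> module.subspace sc I \<and> I \<subseteq> C \<and>
     (\<forall>x\<in>C. \<forall>y\<in>I. br x y \<in> I \<and> br y x \<in> I)"


section \<open>Free Lie algebras\<close>

text \<open>\<open>Gen0\<close> stands for \<open>D\<^sub>0\<close> and \<open>Gen \<iota> n\<close> for \<open>D\<^bsub>\<iota>n\<^esub>\<close>, with \<open>n < N\<^sub>0\<close> representing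
  a residue modulo \<open>N\<^sub>0\<close>. A function \<open>'g magma \<Rightarrow> 'k\<close> is a formal linear combination of
  nonassociative words, and \<open>mprod\<close> is the bilinear extension of \<open>Node\<close>.\<close>

datatype gen = Gen0 | Gen int nat

datatype 'g magma = Leaf 'g | Node "'g magma" "'g magma"

type_synonym 'k words = "gen magma \<Rightarrow> 'k"

fun mprod :: "('g magma \<Rightarrow> 'k::field) \<Rightarrow> ('g magma \<Rightarrow> 'k) \<Rightarrow> 'g magma \<Rightarrow> 'k" where
  "mprod f g (Leaf x) = 0"
| "mprod f g (Node u v) = f u * g v"

definition msc :: "'k::field \<Rightarrow> ('g magma \<Rightarrow> 'k) \<Rightarrow> 'g magma \<Rightarrow> 'k" where
  "msc c f = (\<lambda>t. c * f t)"

definition letter :: "'g \<Rightarrow> 'g magma \<Rightarrow> 'k::field" where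
  "letter g = (\<lambda>t. if t = Leaf g then 1 else 0)"

definition gens :: "'k params \<Rightarrow> int set \<Rightarrow> gen set" where
  "gens P X = {Gen0} \<union> {Gen \<iota> n | \<iota> n. \<iota> \<in> X \<and> n < N0 P}"

definition Dword :: "'k::field params \<Rightarrow> int \<Rightarrow> nat \<Rightarrow> 'k words" where
  "Dword P \<iota> n =
     (if \<iota> = 0 then msc (alpha0 P ^ (chr P ^ n)) (letter Gen0) else letter (Gen \<iota> n))"

text \<open>The free nonassociative algebra on \<open>G\<close>, and its completion, in which infinite
  combinations are allowed (every word counts as a topological basis element).\<close>

definition free_words :: "gen set \<Rightarrow> ('k::field) words set" where
  "free_words G = {f. finite {t. f t \<noteq> 0} \<and> (\<forall>t. f t \<noteq> 0 \<longrightarrow> set_magma t \<subseteq> G)}"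

definition free_words_hat :: "gen set \<Rightarrow> ('k::field) words set" where
  "free_words_hat G = {f. \<forall>t. f t \<noteq> 0 \<longrightarrow> set_magma t \<subseteq> G}"

text \<open>Closed in the product topology, \<open>k\<close> being discrete.\<close>
definition word_closed :: "'k words set \<Rightarrow> bool" where
  "word_closed I \<longleftrightarrow>
     (\<forall>f. (\<forall>T. finite T \<longrightarrow> (\<exists>g\<in>I. \<forall>t\<in>T. g t = f t)) \<longrightarrow> f \<in> I)"

text \<open>The free Lie algebra is the quotient of the free nonassociative algebra by the ideal
  generated by these elements.\<close>
definition lie_rels :: "('k::field) words set \<Rightarrow> 'k words set" where
  "lie_rels C = {mprod x x | x. x \<in> C} \<union>
     {mprod x (mprod y z) + mprod y (mprod z x) + mprod z (mprod x y) | x y z.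
        x \<in> C \<and> y \<in> C \<and> z \<in> C}"


section \<open>Quotients of free Lie algebras and their forms over the prime field\<close>

text \<open>A Lie \<open>k\<close>-algebra \<open>M\<^sub>k\<close> whose underlying set is the type \<open>'l\<close>, together with the
  presentation map \<open>proj\<close> defined on nonassociative words, and the action \<open>frob\<close> of \<open>\<sigma>\<close>
  through \<open>k\<close>. Throughout, the \<open>\<F>\<^sub>p\<close>-algebra \<open>M\<close> is the set of fixed points of \<open>\<sigma>\<close> in
  \<open>M\<^sub>k = M \<otimes> k\<close>.\<close>

record ('k, 'l) lie_form =
  scl :: "'k \<Rightarrow> 'l \<Rightarrow> 'l"
  brk :: "'l \<Rightarrow> 'l \<Rightarrow> 'l"
  frob :: "'l \<Rightarrow> 'l"
  proj :: "'k words \<Rightarrow> 'l"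

text \<open>\<open>'l\<close> is the quotient of the algebra \<open>C\<close> of words by its ideal \<open>K\<close>, and \<open>\<sigma>\<close> is the
  \<open>\<sigma>\<close>-linear automorphism with \<open>D\<^sub>0 \<mapsto> D\<^sub>0\<close>, \<open>D\<^bsub>\<iota>n\<^esub> \<mapsto> D\<^bsub>\<iota>,n+1\<^esub>\<close>.\<close>
definition presented ::
  "'k::field params \<Rightarrow> int set \<Rightarrow> 'k words set \<Rightarrow> 'k words set \<Rightarrow>
   ('k, 'l::ab_group_add) lie_form \<Rightarrow> bool" where
  "presented P X C K L \<longleftrightarrow>
     vector_space (scl L) \<and>
     (\<forall>f\<in>C. \<forall>g\<in>C. proj L (f + g) = proj L f + proj L g) \<and>
     (\<forall>c. \<forall>f\<in>C. proj L (msc c f) = scl L c (proj L f)) \<and>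
     (\<forall>f\<in>C. \<forall>g\<in>C. proj L (mprod f g) = brk L (proj L f) (proj L g)) \<and>
     proj L ` C = UNIV \<and> {f\<in>C. proj L f = 0} = K \<and>
     bij (frob L) \<and>
     (\<forall>x y. frob L (x + y) = frob L x + frob L y) \<and>
     (\<forall>c x. frob L (scl L c x) = scl L (c ^ chr P) (frob L x)) \<and>
     (\<forall>x y. frob L (brk L x y) = brk L (frob L x) (frob L y)) \<and>
     frob L (proj L (letter Gen0)) = proj L (letter Gen0) \<and>
     (\<forall>\<iota>\<in>X. \<forall>n<N0 P. frob L (proj L (letter (Gen \<iota> n))) =
                        proj L (letter (Gen \<iota> (Suc n mod N0 P))))"

definition Fp_form :: "('k, 'l) lie_form \<Rightarrow> 'l set" where
  "Fp_form L = {x. frob L x = x}"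

definition Dgen :: "'k::field params \<Rightarrow> ('k, 'l) lie_form \<Rightarrow> int \<Rightarrow> nat \<Rightarrow> 'l" where
  "Dgen P L \<iota> n = proj L (Dword P \<iota> n)"

text \<open>A subset of \<open>M\<close> closed under subtraction is an \<open>\<F>\<^sub>p\<close>-subspace,
  and an additive map is \<open>\<F>\<^sub>p\<close>-linear.\<close>

definition Fp_ideal :: "('k, 'l::ab_group_add) lie_form \<Rightarrow> 'l set \<Rightarrow> bool" where
  "Fp_ideal L I \<longleftrightarrow> I \<subseteq> Fp_form L \<and> 0 \<in> I \<and> (\<forall>x\<in>I. \<forall>y\<in>I. x - y \<in> I) \<and>
     (\<forall>x\<in>Fp_form L. \<forall>y\<in>I. brk L x y \<in> I)"

definition Fp_lie_hom ::
  "('k, 'l::ab_group_add) lie_form \<Rightarrow> ('k, 'm::ab_group_add) lie_form \<Rightarrow> ('l \<Rightarrow> 'm) \<Rightarrow> bool" where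
  "Fp_lie_hom L M f \<longleftrightarrow> f ` Fp_form L \<subseteq> Fp_form M \<and>
     (\<forall>x\<in>Fp_form L. \<forall>y\<in>Fp_form L. f (x + y) = f x + f y \<and> f (brk L x y) = brk M (f x) (f y))"

definition Fp_lie_aut :: "('k, 'l::ab_group_add) lie_form \<Rightarrow> ('l \<Rightarrow> 'l) \<Rightarrow> bool" where
  "Fp_lie_aut L f \<longleftrightarrow> Fp_lie_hom L L f \<and> bij_betw f (Fp_form L) (Fp_form L)"

definition Fp_derivation :: "('k, 'l::ab_group_add) lie_form \<Rightarrow> ('l \<Rightarrow> 'l) \<Rightarrow> bool" where
  "Fp_derivation L D \<longleftrightarrow> D ` Fp_form L \<subseteq> Fp_form L \<and>
     (\<forall>x\<in>Fp_form L. \<forall>y\<in>Fp_form L.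
        D (x + y) = D x + D y \<and> D (brk L x y) = brk L (D x) y + brk L x (D y))"

text \<open>\<open>F = f \<otimes> k\<close>.\<close>
definition base_change ::
  "('k::field, 'l::ab_group_add) lie_form \<Rightarrow> ('k, 'm::ab_group_add) lie_form \<Rightarrow>
   ('l \<Rightarrow> 'm) \<Rightarrow> ('l \<Rightarrow> 'm) \<Rightarrow> bool" where
  "base_change L M f F \<longleftrightarrow> Vector_Spaces.linear (scl L) (scl M) F \<and>
     (\<forall>x y. F (brk L x y) = brk M (F x) (F y)) \<and> (\<forall>x\<in>Fp_form L. F x = f x)"


section \<open>The algebra \<open>\<L>\<close> modulo \<open>\<L>(p)\<close>\<close>

text \<open>\<open>\<L>\<^sub>k\<close> is profinite with topological free generators \<open>D\<^sub>0\<close>, \<open>D\<^bsub>an\<^esub>\<close>, hence all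
  ideals are closed.\<close>

definition Lbar_words :: "('k::field) params \<Rightarrow> 'k words set" where
  "Lbar_words P = free_words_hat (gens P (Zplus P))"

definition Lbar_kernel :: "('k::field) params \<Rightarrow> 'k words set" where
  "Lbar_kernel P =
     (\<lambda>I. is_ideal msc mprod (Lbar_words P) I \<and> word_closed I) hull
       (lie_rels (Lbar_words P) \<union>
        comm_ge mprod (Lbar_words P \<times> {1}) (chr P) \<union>
        comm_ge mprod {(Dword P a n, wt P a) | a n. a \<in> insert 0 (Zplus P) \<and> n < N0 P} (chr P))"

definition is_Lbar :: "('k::field) params \<Rightarrow> ('k, 'm::ab_group_add) lie_form \<Rightarrow> bool" where
  "is_Lbar P L \<longleftrightarrow> presented P (Zplus P) (Lbar_words P) (Lbar_kernel P) L"


section \<open>The algebra \<open>\<L>\<^sup>\<dagger>\<close> and its quotient\<close>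

definition Ldag_words :: "('k::field) params \<Rightarrow> 'k words set" where
  "Ldag_words P = free_words (gens P (Aplus P))"

text \<open>The quotient of \<open>Ldag_words\<close> by this ideal is \<open>\<L>\<^sup>\<dagger>\<^sub>k\<close>, the free Lie algebra modulo its
  commutators of degree at least \<open>p\<close>. Subspaces of \<open>\<L>\<^sup>\<dagger>\<^sub>k\<close> are given below by their preimages
  in \<open>Ldag_words\<close>, all of which contain it.\<close>
definition Ldag_ideal :: "('k::field) params \<Rightarrow> 'k words set" where
  "Ldag_ideal P = is_ideal msc mprod (Ldag_words P) hull
     (lie_rels (Ldag_words P) \<union> comm_ge mprod (Ldag_words P \<times> {1}) (chr P))"

definition Ldag_filt :: "('k::field) params \<Rightarrow> nat \<Rightarrow> 'k words set" where
  "Ldag_filt P s = module.span msc (Ldag_ideal P \<union>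
     comm_ge mprod {(Dword P \<iota> n, w0 P \<iota>) | \<iota> n. \<iota> \<in> A0p P \<and> n < N0 P} s)"

definition Ldag_gr :: "('k::field) params \<Rightarrow> nat \<Rightarrow> 'k words set" where
  "Ldag_gr P m = module.span msc (Ldag_ideal P \<union>
     comm_eq mprod {(Dword P \<iota> n, ch P \<iota>) | \<iota> n. \<iota> \<in> A0p P \<and> n < N0 P} m)"

definition Ldag_bar_kernel :: "('k::field) params \<Rightarrow> 'k words set" where
  "Ldag_bar_kernel P =
     module.span msc (\<Union>s. \<Union>m\<in>{m. s + m \<ge> chr P}. Ldag_filt P s \<inter> Ldag_gr P m)"

definition is_Ldag_bar :: "('k::field) params \<Rightarrow> ('k, 'l::ab_group_add) lie_form \<Rightarrow> bool" where
  "is_Ldag_bar P L \<longleftrightarrow> presented P (Aplus P) (Ldag_words P) (Ldag_bar_kernel P) L"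

definition gr_k :: "('k::field) params \<Rightarrow> ('k, 'l) lie_form \<Rightarrow> nat \<Rightarrow> 'l set" where
  "gr_k P L m = proj L ` Ldag_gr P m"

definition gr :: "('k::field) params \<Rightarrow> ('k, 'l) lie_form \<Rightarrow> nat \<Rightarrow> 'l set" where
  "gr P L m = gr_k P L m \<inter> Fp_form L"

definition filt_gr_k :: "('k::field) params \<Rightarrow> ('k, 'l) lie_form \<Rightarrow> nat \<Rightarrow> nat \<Rightarrow> 'l set" where
  "filt_gr_k P L s m = proj L ` (Ldag_filt P s \<inter> Ldag_gr P m)"

definition sum_below :: "(nat \<Rightarrow> 'l::ab_group_add set) \<Rightarrow> nat \<Rightarrow> 'l set" where
  "sum_below G m = {\<Sum>i<m. x i | x. \<forall>i<m. x i \<in> G i}"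


section \<open>Extension of scalars to Laurent series\<close>

text \<open>As \<open>M\<close> is finite, \<open>M \<otimes> k((t)) = M\<^sub>k((t))\<close>, which is the type \<open>'l fls\<close> with its
  \<open>t\<close>-adic topology; \<open>fls_shift b (fls_const l)\<close> is \<open>t\<^sup>-\<^sup>b l\<close>.\<close>

definition fls_coeffmap :: "('a::zero \<Rightarrow> 'b::zero) \<Rightarrow> 'a fls \<Rightarrow> 'b fls" where
  "fls_coeffmap F f = Abs_fls (\<lambda>n. F (f $$ n))"

definition fls_scl :: "('k, 'l::ab_group_add) lie_form \<Rightarrow> 'k \<Rightarrow> 'l fls \<Rightarrow> 'l fls" where
  "fls_scl L c = fls_coeffmap (scl L c)"

definition fls_brk :: "('k, 'l::ab_group_add) lie_form \<Rightarrow> 'l fls \<Rightarrow> 'l fls \<Rightarrow> 'l fls" where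
  "fls_brk L f g =
     Abs_fls (\<lambda>n. \<Sum>i | f $$ i \<noteq> 0 \<and> g $$ (n - i) \<noteq> 0. brk L (f $$ i) (g $$ (n - i)))"

definition fls_frob :: "'k params \<Rightarrow> ('k, 'l::ab_group_add) lie_form \<Rightarrow> 'l fls \<Rightarrow> 'l fls" where
  "fls_frob P L f = fls_compose_power (fls_coeffmap (frob L) f) (chr P)"

fun right_nested :: "('a \<Rightarrow> 'a \<Rightarrow> 'a::zero) \<Rightarrow> 'a list \<Rightarrow> 'a" where
  "right_nested br [] = 0"
| "right_nested br [x] = x"
| "right_nested br (x # y # zs) = br x (right_nested br (y # zs))"

text \<open>Dynkin's form of the Campbell--Hausdorff series, truncated at total degree \<open>p\<close>:
  the summand for \<open>(r\<^sub>1,s\<^sub>1),\<dots>,(r\<^sub>n,s\<^sub>n)\<close> is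
  \<open>(-1)\<^sup>n\<^sup>-\<^sup>1 / (n (\<Sum>r\<^sub>i+s\<^sub>i) \<Prod>r\<^sub>i! s\<^sub>i!)\<close> times the right-normed commutator of
  \<open>x\<^sup>r\<^sup>1 y\<^sup>s\<^sup>1 \<dots> x\<^sup>r\<^sup>n y\<^sup>s\<^sup>n\<close>. The denominators are prime to \<open>p\<close>.\<close>

definition ch_index :: "nat \<Rightarrow> (nat \<times> nat) list set" where
  "ch_index p = {rs. rs \<noteq> [] \<and> (\<forall>(r, s)\<in>set rs. 0 < r + s) \<and> (\<Sum>(r, s)\<leftarrow>rs. r + s) < p}"

definition ch_coeff :: "(nat \<times> nat) list \<Rightarrow> 'k::field" where
  "ch_coeff rs = (- 1) ^ (length rs - 1) /
     of_nat (length rs * (\<Sum>(r, s)\<leftarrow>rs. r + s) * (\<Prod>(r, s)\<leftarrow>rs. fact r * fact s))"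

definition CH ::
  "nat \<Rightarrow> ('k::field \<Rightarrow> 'a::ab_group_add \<Rightarrow> 'a) \<Rightarrow> ('a \<Rightarrow> 'a \<Rightarrow> 'a) \<Rightarrow> 'a \<Rightarrow> 'a \<Rightarrow> 'a" where
  "CH p sc br x y = (\<Sum>rs\<in>ch_index p. sc (ch_coeff rs)
     (right_nested br (concat (map (\<lambda>(r, s). replicate r x @ replicate s y) rs))))"

text \<open>The truncated exponential of \<open>\<gamma> D\<close>, for \<open>\<gamma>\<close> representing a residue mod \<open>p\<close>.\<close>
definition trunc_exp ::
  "'k::field params \<Rightarrow> ('k, 'l::ab_group_add) lie_form \<Rightarrow> nat \<Rightarrow> ('l \<Rightarrow> 'l) \<Rightarrow> 'l \<Rightarrow> 'l" where
  "trunc_exp P L \<gamma> D x =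
     (\<Sum>i<chr P. scl L (of_nat \<gamma> ^ i / of_nat (fact i)) ((D ^^ i) x))"


section \<open>The algebras \<open>\<N>\<^sup>\<dagger>\<close> and \<open>\<N>\<^sup>s\<^sup>p\<close>\<close>

definition Ndag :: "('k::field) params \<Rightarrow> ('k, 'l::ab_group_add) lie_form \<Rightarrow> 'l fls set" where
  "Ndag P L = closure (module.span (fls_scl L)
     {fls_shift b (fls_const l) | b l s m.
        l \<in> filt_gr_k P L s m \<and> b < (int s + int m) * bstar P})"

text \<open>\<open>t\<^bsup>(p-1)b*\<^esup> \<N>\<^sup>\<dagger>\<close>. Elements of the quotient of \<open>\<N>\<^sup>\<dagger>\<close> by it
  are represented by Laurent series, and equality there is congruence modulo \<open>Ndag_small\<close>.\<close>
definition Ndag_small :: "('k::field) params \<Rightarrow> ('k, 'l::ab_group_add) lie_form \<Rightarrow> 'l fls set" where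
  "Ndag_small P L = fls_shift (- ((int (chr P) - 1) * bstar P)) ` Ndag P L"

text \<open>With \<open>j = 0\<close> the span of the distinguished generators of \<open>\<N>\<^sup>s\<^sup>p\<close>, with \<open>j = 1\<close> that of the
  generators of \<open>\<N>\<^sup>s\<^sup>p\<langle>1\<rangle>\<close>; the modules themselves are the images in the quotient.\<close>
definition Nsp_span ::
  "('k::field) params \<Rightarrow> ('k, 'l::ab_group_add) lie_form \<Rightarrow> nat \<Rightarrow> 'l fls set" where
  "Nsp_span P L j = module.span (fls_scl L)
     {fls_shift \<iota> (fls_const l) | \<iota> l s m.
        \<iota> \<in> A0 P \<and> l \<in> filt_gr_k P L s m \<and>
        \<iota> + int (ch P \<iota>) * bstar P < (int s + int m) * bstar P \<and>
        m + j \<le> ch P \<iota> \<and> kappa P \<iota> \<le> (chr P - 2) * m + s}"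

definition represents_Nsp ::
  "('k::field) params \<Rightarrow> ('k, 'l::ab_group_add) lie_form \<Rightarrow> nat \<Rightarrow> 'l fls \<Rightarrow> bool" where
  "represents_Nsp P L j f \<longleftrightarrow> (\<exists>g\<in>Nsp_span P L j. f - g \<in> Ndag_small P L)"

text \<open>\<open>\<Omega>\<^sub>\<gamma>\<close> on Laurent polynomials in \<open>Nsp_span P L 0\<close>, whose exponents are the \<open>-\<iota>\<close>
  with \<open>\<iota> \<in> A0 P\<close>.\<close>
definition Omega ::
  "('k::field) params \<Rightarrow> ('k, 'l::ab_group_add) lie_form \<Rightarrow> nat \<Rightarrow> 'l fls \<Rightarrow> 'l fls" where
  "Omega P L \<gamma> f = (\<Sum>\<iota>\<in>A0 P. \<Sum>i<chr P.
     fls_shift (\<iota> - int i * bstar P) (fls_const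
       (scl L ((of_nat \<gamma> * of_int (alpha_part P \<iota>)) ^ i / of_nat (fact i)) (f $$ (- \<iota>)))))"


section \<open>The data \<open>e\<^sup>s\<^sup>p\<close>, \<open>A\<^sup>\<dagger>\<^sub>\<gamma>\<close>, \<open>B\<^sup>\<dagger>\<close> and \<open>\<V>\<close>\<close>

definition C2_fls :: "('k::field, 'l::ab_group_add) lie_form \<Rightarrow> 'l fls set" where
  "C2_fls L = (\<lambda>I. is_ideal (fls_scl L) (fls_brk L) UNIV I \<and> closed I) hull
     comm_ge (fls_brk L) (UNIV \<times> {1}) 2"

definition is_esp :: "('k::field) params \<Rightarrow> ('k, 'l::ab_group_add) lie_form \<Rightarrow> 'l fls \<Rightarrow> bool" where
  "is_esp P L e \<longleftrightarrow> e \<in> Ndag P L \<and>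
     e - (\<Sum>\<iota>\<in>A0p P. fls_shift \<iota> (fls_const (Dgen P L \<iota> 0))) \<in> C2_fls L \<and>
     represents_Nsp P L 0 e"

text \<open>\<open>f = A\<^sup>\<dagger>\<^sub>\<gamma>\<close>. Here \<open>e0\<close> is a lift of the class of \<open>e\<close> to a combination of the generators of
  \<open>\<N>\<^sup>s\<^sup>p\<close>, to which \<open>\<Omega>\<^sub>\<gamma>\<close> is applied.\<close>
definition is_Adag ::
  "('k::field) params \<Rightarrow> ('k, 'l::ab_group_add) lie_form \<Rightarrow> 'l fls \<Rightarrow> nat \<Rightarrow> ('l \<Rightarrow> 'l) \<Rightarrow> bool" where
  "is_Adag P L e \<gamma> f \<longleftrightarrow> Fp_lie_aut L f \<and>
     (\<exists>F c e0. base_change L L f F \<and>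
        represents_Nsp P L 1 c \<and> represents_Nsp P L 1 (fls_frob P L c) \<and>
        e0 \<in> Nsp_span P L 0 \<and> e - e0 \<in> Ndag_small P L \<and>
        Omega P L \<gamma> e0 -
          CH (chr P) (fls_scl L) (fls_brk L)
            (CH (chr P) (fls_scl L) (fls_brk L) (fls_frob P L c) (fls_coeffmap F e)) (- c)
          \<in> Ndag_small P L \<and>
        (\<forall>\<iota>\<in>A0p P. F (Dgen P L \<iota> 0) - Dgen P L \<iota> 0 \<in> sum_below (gr_k P L) (ch P \<iota>)))"

definition is_Bdag ::
  "('k::field) params \<Rightarrow> ('k, 'l::ab_group_add) lie_form \<Rightarrow> (nat \<Rightarrow> 'l \<Rightarrow> 'l) \<Rightarrow> ('l \<Rightarrow> 'l) \<Rightarrow> bool" where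
  "is_Bdag P L A B \<longleftrightarrow> Fp_derivation L B \<and>
     (\<forall>m. B ` gr P L m \<subseteq> sum_below (gr P L) m) \<and>
     (\<forall>\<gamma><chr P. \<forall>x\<in>Fp_form L. A \<gamma> x = trunc_exp P L \<gamma> B x)"

definition is_V ::
  "('k::field) params \<Rightarrow> ('k, 'l::ab_group_add) lie_form \<Rightarrow> ('k, 'm::ab_group_add) lie_form \<Rightarrow>
   ('l \<Rightarrow> 'm) \<Rightarrow> bool" where
  "is_V P Ld L V \<longleftrightarrow> Fp_lie_hom Ld L V \<and> V ` Fp_form Ld = Fp_form L \<and>
     (\<exists>Vk. base_change Ld L V Vk \<and>
        (\<forall>a\<in>insert 0 (Zplus P). \<forall>n<N0 P. int (qq P) * a \<in> A0p P \<and> ch P (int (qq P) * a) = 0 \<longrightarrow>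
           Vk (Dgen P Ld (int (qq P) * a) n) = Dgen P L a n) \<and>
        (\<forall>\<iota>\<in>A0p P. \<forall>n<N0 P. 1 \<le> ch P \<iota> \<longrightarrow> Vk (Dgen P Ld \<iota> n) = 0))"

end

theory Submission
  imports Defs "HOL-Number_Theory.Residues"
begin

text \<open>
  The Lie algebra \<open>\<L>\<^sup>\<dagger>\<^sub>k\<close> is spanned by commutators of \<open>ch\<close>-degree \<open>0\<close> and by commutators of
  positive degree; both spans are stable under \<open>\<sigma>\<close> and \<open>\<V>\<close> kills the second. Multiplying by
  \<open>\<alpha>\<^sub>0\<close> and taking the trace over the powers of \<open>\<sigma>\<close> descends this to \<open>\<F>\<^sub>p\<close>: every \<open>x\<close> in
  \<open>\<L>\<^sup>\<dagger>\<close> is \<open>y + z\<close> with \<open>y\<close> of degree \<open>0\<close> and \<open>z\<close> in the kernel of \<open>\<V>\<close>. As \<open>B\<close> strictly lowers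
  the degree, \<open>B y = 0\<close>, so b) already gives \<open>B x = B z \<in> \<V>\<^sup>-\<^sup>1(I)\<close> for all \<open>x\<close>, hence the
  same for all powers of \<open>B\<close>, and a) follows.
  Conversely, \<open>B\<close> is recovered as the \<open>\<F>\<^sub>p\<close>-combination \<open>-\<Sum>\<^sub>\<gamma> \<gamma>\<^sup>p\<^sup>-\<^sup>2 A\<^sub>\<gamma>\<close>.
\<close>

section \<open>Finite fields\<close>

text \<open>Multiplication by a nonzero \<open>x\<close> permutes the nonzero elements; comparing
  the two products gives \<open>x ^ (card UNIV - 1) = 1\<close>.\<close>

lemma power_card_UNIV:
  fixes x :: "'k::{field,finite}"
  shows "x ^ card (UNIV :: 'k set) = x"
proof (cases "x = 0")
  case False
  let ?S = "UNIV - {0 :: 'k}"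
  have "(\<Prod>y\<in>?S. x * y) = \<Prod>?S"
    by (rule prod.reindex_bij_witness[of _ "\<lambda>y. y / x" "\<lambda>y. x * y"]) (use False in auto)
  then have "x ^ card ?S = 1"
    by (simp add: prod.distrib)
  then have "x ^ Suc (card ?S) = x"
    by simp
  moreover have "Suc (card ?S) = card (UNIV :: 'k set)"
    by (rule card.remove[symmetric]) simp_all
  ultimately show ?thesis
    by metis
qed (simp add: card_gt_0_iff)

text \<open>The parameters fix \<open>chr P\<close> only through the cardinality of the field; this
  identifies it with the characteristic, which is a prime divisor of \<open>p ^ n\<close>.\<close>

lemma CHAR_eq_if_card_eq_prime_power:
  assumes "prime p" and "card (UNIV :: 'k::{field,finite} set) = p ^ n"
  shows "CHAR('k) = p"
proof -
  have "CHAR('k) > 0"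
    by (rule finite_imp_CHAR_pos) simp
  then have "prime CHAR('k)"
    by (rule prime_CHAR_semidom)
  moreover have "CHAR('k) dvd p ^ n"
    using CHAR_dvd_CARD[where 'a = 'k] assms(2) by simp
  ultimately show ?thesis
    using assms(1) by (metis prime_dvd_power primes_dvd_imp_eq)
qed

section \<open>Arithmetic and power sums in the prime subfield\<close>

lemma of_nat_fermat:
  assumes "prime CHAR('k::field)" and "(of_nat a :: 'k) \<noteq> 0"
  shows "(of_nat a :: 'k) ^ (CHAR('k) - 1) = 1"
proof -
  have "\<not> CHAR('k) dvd a"
    using assms(2) by (simp add: of_nat_eq_0_iff_char_dvd)
  then have "[a ^ (CHAR('k) - 1) = 1] (mod CHAR('k))"
    using assms(1) by (intro fermat_theorem)
  then have "(of_nat (a ^ (CHAR('k) - 1)) :: 'k) = of_nat 1"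
    by (subst of_nat_eq_iff_cong_CHAR)
  then show ?thesis
    by simp
qed

text \<open>By Fermat a nonzero \<open>b\<close> has inverse \<open>b ^ (p - 2)\<close>; for
  \<open>b = 0\<close> the quotient is 0 by convention. It puts the coefficients of the truncated
  exponential into the prime field, so that subgroups absorb them.\<close>

lemma of_nat_divide_of_nat_is_of_nat:
  assumes "prime CHAR('k::field)"
  shows "\<exists>j. (of_nat a / of_nat b :: 'k) = of_nat j"
proof (cases "(of_nat b :: 'k) = 0")
  case True
  then show ?thesis
    by (intro exI[of _ 0]) simp
next
  case False
  have "CHAR('k) - 1 = Suc (CHAR('k) - 2)"
    using prime_ge_2_nat[OF assms] by simp
  then have "(of_nat b :: 'k) * of_nat b ^ (CHAR('k) - 2) = 1"
    using of_nat_fermat[OF assms False] by simp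
  then have "of_nat a / of_nat b = (of_nat (a * b ^ (CHAR('k) - 2)) :: 'k)"
    using False by (simp add: field_simps)
  then show ?thesis
    by blast
qed

text \<open>The differences \<open>(g + 1) ^ (j + 1) - g ^ (j + 1)\<close> telescope to a power of
  \<open>p\<close>, which is 0. Expanding them binomially and cancelling the lower power sums by
  induction leaves \<open>(j + 1) * S j = 0\<close>, where \<open>j + 1 < p\<close> is
  invertible.\<close>

lemma sum_powers_prime_field_eq_0:
  assumes "prime CHAR('k::field)" and "j < CHAR('k) - 1"
  shows "(\<Sum>g<CHAR('k). (of_nat g :: 'k) ^ j) = 0"
  using assms(2)
proof (induction j rule: less_induct)
  case (less j)
  let ?p = "CHAR('k)"
  let ?S = "\<lambda>i. \<Sum>g<?p. (of_nat g :: 'k) ^ i"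
  have "0 = (of_nat ?p :: 'k) ^ Suc j - of_nat 0 ^ Suc j"
    by simp
  also have "\<dots> = (\<Sum>g<?p. of_nat (Suc g) ^ Suc j - of_nat g ^ Suc j)"
    by (rule sum_lessThan_telescope[symmetric])
  also have "\<dots> = (\<Sum>g<?p. \<Sum>i\<le>j. of_nat (Suc j choose i) * of_nat g ^ i)"
  proof (rule sum.cong[OF refl])
    fix g
    have "(of_nat (Suc g) :: 'k) ^ Suc j = (of_nat g + 1) ^ Suc j"
      by (simp add: add.commute)
    also have "\<dots> = (\<Sum>i\<le>Suc j. of_nat (Suc j choose i) * of_nat g ^ i)"
      by (subst binomial_ring) simp
    also have "\<dots> = (\<Sum>i\<le>j. of_nat (Suc j choose i) * of_nat g ^ i) + of_nat g ^ Suc j"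
      by simp
    finally show "(of_nat (Suc g) :: 'k) ^ Suc j - of_nat g ^ Suc j =
        (\<Sum>i\<le>j. of_nat (Suc j choose i) * of_nat g ^ i)"
      by simp
  qed
  also have "\<dots> = (\<Sum>i\<le>j. of_nat (Suc j choose i) * ?S i)"
    by (subst sum.swap) (simp add: sum_distrib_left)
  also have "\<dots> = (\<Sum>i<j. of_nat (Suc j choose i) * ?S i) + of_nat (Suc j) * ?S j"
    by (simp add: lessThan_Suc_atMost[symmetric] del: of_nat_Suc)
  also have "(\<Sum>i<j. of_nat (Suc j choose i) * ?S i) = 0"
    using less by (intro sum.neutral) auto
  finally have "of_nat (Suc j) * ?S j = 0"
    by simp
  moreover have "(of_nat (Suc j) :: 'k) \<noteq> 0"
    using less.prems by (auto simp: of_nat_eq_0_iff_char_dvd dest!: dvd_imp_le simp del: of_nat_Suc)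
  ultimately show ?case
    by (metis mult_eq_0_iff)
qed

text \<open>The weight \<open>g ^ (p - 2)\<close> equals \<open>1 / g\<close> for nonzero
  \<open>g\<close>, so this orthogonality relation picks out the linear coefficient of a polynomial
  in \<open>g\<close> of degree below \<open>p\<close>.\<close>

lemma sum_powers_prime_field_shifted:
  assumes prime: "prime CHAR('k::field)" and "i < CHAR('k)"
  shows "(\<Sum>g<CHAR('k). (of_nat g :: 'k) ^ (CHAR('k) - 2 + i)) = (if i = 1 then - 1 else 0)"
proof -
  let ?p = "CHAR('k)"
  have p2: "?p \<ge> 2"
    using prime by (rule prime_ge_2_nat)
  have nz: "(of_nat g :: 'k) \<noteq> 0" if "g \<in> {..<?p} - {0}" for g
    using that by (auto simp: of_nat_eq_0_iff_char_dvd dest!: dvd_imp_le)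
  consider "i = 0" | "i = 1" | "i \<ge> 2"
    by linarith
  then show ?thesis
  proof cases
    case 1
    then show ?thesis
      using sum_powers_prime_field_eq_0[OF prime, of "?p - 2"] p2 by simp
  next
    case 2
    have "(\<Sum>g<?p. (of_nat g :: 'k) ^ (?p - 1)) = (\<Sum>g\<in>{..<?p} - {0}. of_nat g ^ (?p - 1))"
      using p2 by (intro sum.mono_neutral_right) auto
    also have "\<dots> = (\<Sum>g\<in>{..<?p} - {0}. 1)"
      using nz by (intro sum.cong refl of_nat_fermat prime)
    also have "\<dots> = of_nat (?p - 1)"
      using p2 by simp
    also have "\<dots> = - 1"
      using p2 by (simp add: of_nat_diff)
    finally show ?thesis
      using 2 p2 by (simp add: Suc_diff_Suc numeral_2_eq_2)
  next
    case 3
    \<comment> \<open>Fermat lowers the exponent by \<open>p - 1\<close>. It says nothing at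
      \<open>g = 0\<close>, but there both sides vanish, as both exponents are positive.\<close>
    have "(of_nat g :: 'k) ^ (?p - 2 + i) = of_nat g ^ (i - 1)" if "g < ?p" for g
    proof (cases "g = 0")
      case False
      have "(of_nat g :: 'k) ^ (?p - 1) = 1"
        using that False by (intro of_nat_fermat prime nz) simp
      moreover have "?p - 2 + i = (?p - 1) + (i - 1)"
        using 3 p2 by simp
      ultimately show ?thesis
        by (metis mult_1 power_add)
    qed (use 3 p2 in \<open>simp add: power_0_left\<close>)
    then show ?thesis
      using sum_powers_prime_field_eq_0[OF prime, of "i - 1"] 3 assms(2) by simp
  qed
qed


section \<open>Words\<close>

interpretation msc: vector_space "msc :: 'k::field \<Rightarrow> ('g magma \<Rightarrow> 'k) \<Rightarrow> _"
  by unfold_locales (auto simp: msc_def algebra_simps fun_eq_iff)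

lemma mprod_msc_left: "mprod (msc c f) g = msc c (mprod f g)"
  and mprod_msc_right: "mprod f (msc c g) = msc c (mprod f g)"
  by (rule ext, rename_tac t, case_tac t; simp add: msc_def algebra_simps)+

lemma mprod_zero_left [simp]: "mprod 0 g = 0" and mprod_zero_right [simp]: "mprod f 0 = 0"
  by (rule ext, rename_tac t, case_tac t; simp)+

definition word :: "'g magma \<Rightarrow> 'g magma \<Rightarrow> 'k::field" where
  "word t = (\<lambda>s. if s = t then 1 else 0)"

lemma word_Node: "word (Node u v) = mprod (word u) (word v)"
  by (rule ext, rename_tac t, case_tac t) (auto simp: word_def)

lemma word_Leaf: "word (Leaf g) = letter g"
  by (auto simp: word_def letter_def)

lemma zero_in_free_words: "0 \<in> free_words G"
  by (simp add: free_words_def)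

lemma add_in_free_words:
  assumes "f \<in> free_words G" "g \<in> free_words G"
  shows "f + g \<in> free_words G"
proof -
  have sub: "{t. (f + g) t \<noteq> 0} \<subseteq> {t. f t \<noteq> 0} \<union> {t. g t \<noteq> 0}"
    by auto
  then have "finite {t. (f + g) t \<noteq> 0}"
    using assms by (auto simp: free_words_def intro: finite_subset)
  then show ?thesis
    using assms sub unfolding free_words_def by blast
qed

lemma msc_in_free_words: "f \<in> free_words G \<Longrightarrow> msc c f \<in> free_words G"
  by (auto simp: free_words_def msc_def intro: rev_finite_subset)

lemma letter_in_free_words: "g \<in> G \<Longrightarrow> letter g \<in> free_words G"
  by (auto simp: free_words_def letter_def split: if_splits)

lemma mprod_in_free_words:
  assumes "f \<in> free_words G" "g \<in> free_words G"
  shows "mprod f g \<in> free_words G"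
proof -
  have eq: "\<exists>u v. t = Node u v \<and> f u \<noteq> 0 \<and> g v \<noteq> 0" if "mprod f g t \<noteq> 0" for t
    using that by (cases t) auto
  have "{t. mprod f g t \<noteq> 0} \<subseteq> case_prod Node ` ({t. f t \<noteq> 0} \<times> {t. g t \<noteq> 0})"
    using eq by force
  then have "finite {t. mprod f g t \<noteq> 0}"
    using assms by (auto simp: free_words_def intro: finite_subset)
  then show ?thesis
    using assms eq unfolding free_words_def by fastforce
qed

text \<open>A finitely supported function is the sum of its values times the indicators of the words
  in its support.\<close>

lemma free_words_subset_span: "free_words G \<subseteq> msc.span {word t | t. set_magma t \<subseteq> G}"
proof
  fix f :: "gen magma \<Rightarrow> 'a::field"
  assume f: "f \<in> free_words G"
  let ?S = "{t. f t \<noteq> 0}"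
  have fin: "finite ?S"
    using f by (simp add: free_words_def)
  have "f = (\<Sum>t\<in>?S. msc (f t) (word t))"
  proof
    fix s
    have "(\<Sum>t\<in>?S. msc (f t) (word t)) s = (\<Sum>t\<in>?S. if s = t then f t else 0)"
      using fin by (induction rule: infinite_finite_induct)
        (auto simp: msc_def word_def zero_fun_def plus_fun_def)
    also have "\<dots> = f s"
      using fin by (simp add: sum.delta)
    finally show "f s = (\<Sum>t\<in>?S. msc (f t) (word t)) s"
      by simp
  qed
  moreover have "(\<Sum>t\<in>?S. msc (f t) (word t)) \<in> msc.span {word t | t. set_magma t \<subseteq> G}"
    using f by (intro msc.span_sum msc.span_scale msc.span_base) (auto simp: free_words_def)
  ultimately show "f \<in> msc.span {word t | t. set_magma t \<subseteq> G}"
    by simp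
qed


section \<open>Commutators in a presented algebra\<close>

text \<open>The bracket is described through products of words, so the other argument is lifted
  along the surjection \<open>proj\<close>. Keeping \<open>C\<close> general covers both the finite
  and the completed words.\<close>

lemma presented_brk_zero:
  assumes "presented P X C K M" and "0 \<in> C"
  shows "brk M 0 y = 0" and "brk M x 0 = 0"
proof -
  have mult: "proj M (mprod f g) = brk M (proj M f) (proj M g)" if "f \<in> C" "g \<in> C" for f g
    using assms(1) that by (simp add: presented_def)
  have add: "proj M (f + g) = proj M f + proj M g" if "f \<in> C" "g \<in> C" for f g
    using assms(1) that by (simp add: presented_def)
  have zero: "proj M 0 = 0"
    using add[of 0 0] assms(2) by simp
  have "proj M ` C = UNIV"
    using assms(1) by (simp add: presented_def)
  then have surj: "\<exists>f\<in>C. proj M f = x" for x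
    by (metis UNIV_I imageE)
  show "brk M 0 y = 0"
    using surj[of y] mult[of 0] zero assms(2) by (metis mprod_zero_left)
  show "brk M x 0 = 0"
    using surj[of x] mult[of _ 0] zero assms(2) by (metis mprod_zero_right)
qed

text \<open>An abstraction of the quotient of \<L>-dagger, with \<open>deg\<close> later
  instantiated by \<open>ch\<close>. The label 0 stays outside \<open>X\<close> because
  \<open>Dword P 0 n\<close> denotes a multiple of the letter \<open>Gen0\<close>.\<close>

locale graded_presentation =
  fixes P :: "'k::{field,finite} params"
    and X :: "int set"
    and K :: "'k words set"
    and M :: "('k, 'l::ab_group_add) lie_form"
    and deg :: "int \<Rightarrow> nat"
  assumes presented: "presented P X (free_words (gens P X)) K M"
    and zero_notin: "0 \<notin> X"
    and card_UNIV: "card (UNIV :: 'k set) = chr P ^ N0 P"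
    and trace_alpha0: "(\<Sum>i<N0 P. alpha0 P ^ (chr P ^ i)) = 1"
begin

sublocale vector_space "scl M"
  using presented by (simp add: presented_def)

abbreviation "words \<equiv> free_words (gens P X)"

text \<open>At \<iota> = 0 all conjugate multiples of \<open>Gen0\<close> are included, which makes
  the images in the algebra a set stable under Frobenius.\<close>

definition "gen_words = {(Dword P \<iota> n, deg \<iota>) | \<iota> n. \<iota> \<in> insert 0 X \<and> n < N0 P}"

definition "gen_elems = {(Dgen P M \<iota> n, deg \<iota>) | \<iota> n. \<iota> \<in> insert 0 X \<and> n < N0 P}"

lemma
  shows proj_add: "f \<in> words \<Longrightarrow> g \<in> words \<Longrightarrow> proj M (f + g) = proj M f + proj M g"
    and proj_msc: "f \<in> words \<Longrightarrow> proj M (msc c f) = scl M c (proj M f)"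
    and proj_mprod: "f \<in> words \<Longrightarrow> g \<in> words \<Longrightarrow> proj M (mprod f g) = brk M (proj M f) (proj M g)"
    and frob_add: "frob M (x + y) = frob M x + frob M y"
    and frob_scl: "frob M (scl M c x) = scl M (c ^ chr P) (frob M x)"
    and frob_brk: "frob M (brk M x y) = brk M (frob M x) (frob M y)"
    and frob_Gen0: "frob M (proj M (letter Gen0)) = proj M (letter Gen0)"
    and frob_Gen: "\<iota> \<in> X \<Longrightarrow> n < N0 P \<Longrightarrow>
      frob M (proj M (letter (Gen \<iota> n))) = proj M (letter (Gen \<iota> (Suc n mod N0 P)))"
  using presented by (simp_all add: presented_def)

lemma proj_surj: "\<exists>f\<in>words. proj M f = x"
proof -
  have "proj M ` words = UNIV"
    using presented by (simp add: presented_def)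
  then show ?thesis
    by (metis UNIV_I imageE)
qed

lemma proj_zero: "proj M 0 = 0"
  using proj_add[of 0 0] by (simp add: zero_in_free_words)

lemma frob_zero: "frob M 0 = 0"
  using frob_add[of 0 0] by simp

lemma frob_sum: "frob M (\<Sum>i\<in>T. h i) = (\<Sum>i\<in>T. frob M (h i))"
  by (induction T rule: infinite_finite_induct) (simp_all add: frob_zero frob_add)

lemma N0_pos: "N0 P > 0"
  using trace_alpha0 by (cases "N0 P") auto

lemma alpha0_nonzero: "alpha0 P \<noteq> 0"
proof
  assume zero: "alpha0 P = 0"
  \<comment> \<open>This excludes the convention \<open>0 ^ 0 = 1\<close>: with
    \<open>chr P = 0\<close> the summands with \<open>i > 0\<close> would be 1 even for
    \<open>alpha0 P = 0\<close>.\<close>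
  have "chr P \<noteq> 0"
    using card_UNIV N0_pos finite_UNIV_card_ge_0[where 'a = 'k] by (auto simp: power_0_left)
  then show False
    using trace_alpha0 zero by (simp add: power_0_left)
qed

lemma Dword_in_words: "\<iota> \<in> insert 0 X \<Longrightarrow> n < N0 P \<Longrightarrow> Dword P \<iota> n \<in> words"
  by (auto simp: Dword_def gens_def intro!: msc_in_free_words letter_in_free_words)

lemma frob_Dgen:
  assumes "\<iota> \<in> insert 0 X" "n < N0 P"
  shows "frob M (Dgen P M \<iota> n) = Dgen P M \<iota> (Suc n mod N0 P)"
proof (cases "\<iota> = 0")
  case True
  have G: "letter Gen0 \<in> words"
    by (auto simp: gens_def intro!: letter_in_free_words)
  \<comment> \<open>The only real case is the wrap-around \<open>Suc n = N0 P\<close>, where the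
    exponent on the left is the cardinality of the field.\<close>
  have "alpha0 P ^ (chr P ^ Suc n) = alpha0 P ^ (chr P ^ (Suc n mod N0 P))"
  proof (cases "Suc n = N0 P")
    case True
    then show ?thesis
      using power_card_UNIV[of "alpha0 P"] by (simp only: card_UNIV) simp
  next
    case False
    then show ?thesis
      using assms(2) by simp
  qed
  then have "(alpha0 P ^ (chr P ^ n)) ^ chr P = alpha0 P ^ (chr P ^ (Suc n mod N0 P))"
    by (simp add: power_mult[symmetric] mult.commute)
  then show ?thesis
    by (simp only: True Dgen_def Dword_def proj_msc[OF G] frob_scl frob_Gen0 simp_thms if_True)
next
  case False
  then show ?thesis
    using assms by (simp add: Dgen_def Dword_def frob_Gen)
qed

section \<open>Iterates of Frobenius and their action on commutators\<close>

lemma funpow_frob_add: "(frob M ^^ k) (x + y) = (frob M ^^ k) x + (frob M ^^ k) y"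
  and funpow_frob_scl: "(frob M ^^ k) (scl M c x) = scl M (c ^ (chr P ^ k)) ((frob M ^^ k) x)"
  and funpow_frob_brk: "(frob M ^^ k) (brk M x y) = brk M ((frob M ^^ k) x) ((frob M ^^ k) y)"
  by (induction k) (simp_all add: frob_add frob_scl frob_brk power_mult[symmetric] mult.commute)

lemma funpow_frob_zero: "(frob M ^^ k) 0 = 0"
  by (induction k) (simp_all add: frob_zero)

lemma funpow_frob_Dgen:
  assumes "\<iota> \<in> insert 0 X" "n < N0 P"
  shows "(frob M ^^ k) (Dgen P M \<iota> n) = Dgen P M \<iota> ((n + k) mod N0 P)"
proof (induction k)
  case (Suc k)
  then show ?case
    using frob_Dgen[OF assms(1), of "(n + k) mod N0 P"] N0_pos by (simp add: mod_Suc_eq)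
qed (use assms in simp)

lemma comm_frob:
  assumes "(x, d) \<in> comm (brk M) gen_elems"
  shows "(frob M x, d) \<in> comm (brk M) gen_elems"
  using assms
proof (induction rule: comm.induct)
  case (base x d)
  then obtain \<iota> n where "x = Dgen P M \<iota> n" "d = deg \<iota>" "\<iota> \<in> insert 0 X" "n < N0 P"
    by (auto simp: gen_elems_def)
  then have "frob M x = Dgen P M \<iota> (Suc n mod N0 P)" "Suc n mod N0 P < N0 P" "\<iota> \<in> insert 0 X"
    "d = deg \<iota>"
    using N0_pos by (simp_all only: frob_Dgen mod_less_divisor)
  then have "(frob M x, d) \<in> gen_elems"
    unfolding gen_elems_def by blast
  then show ?case
    by (rule comm.base)
next
  case (brak x d y e)
  then show ?case
    by (simp add: frob_brk comm.brak)
qed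

lemma span_frob:
  assumes "x \<in> span S" and "\<And>s. s \<in> S \<Longrightarrow> frob M s \<in> S"
  shows "frob M x \<in> span S"
  using assms(1)
proof (induction rule: span_induct_alt)
  case base
  then show ?case
    by (simp add: frob_zero span_zero)
next
  case (step c s y)
  then show ?case
    by (simp add: frob_add frob_scl assms(2) span_add span_scale span_base)
qed

lemma comm_frob_period:
  assumes "(x, d) \<in> comm (brk M) gen_elems"
  shows "(frob M ^^ N0 P) x = x"
  using assms
proof (induction rule: comm.induct)
  case (base x d)
  then show ?case
    by (auto simp: gen_elems_def funpow_frob_Dgen)
qed (simp add: funpow_frob_brk)

section \<open>Passage between commutators of words and commutators in the algebra\<close>

lemma comm_gen_words:
  assumes "(f, d) \<in> comm mprod gen_words"
  shows "f \<in> words" and "(proj M f, d) \<in> comm (brk M) gen_elems"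
proof -
  have "f \<in> words \<and> (proj M f, d) \<in> comm (brk M) gen_elems"
    using assms
  proof (induction rule: comm.induct)
    case (base f d)
    then have "f \<in> words" and "(proj M f, d) \<in> gen_elems"
      by (auto simp: gen_words_def gen_elems_def Dgen_def Dword_in_words)
    then show ?case
      by (blast intro: comm.base)
  next
    case (brak f d g e)
    then show ?case
      by (simp add: mprod_in_free_words proj_mprod comm.brak)
  qed
  then show "f \<in> words" and "(proj M f, d) \<in> comm (brk M) gen_elems"
    by simp_all
qed

lemma comm_gen_elems_lift:
  assumes "(x, d) \<in> comm (brk M) gen_elems"
  shows "\<exists>f. (f, d) \<in> comm mprod gen_words \<and> proj M f = x"
  using assms
proof (induction rule: comm.induct)
  case (base x d)
  then obtain \<iota> n where "x = proj M (Dword P \<iota> n)" "(Dword P \<iota> n, d) \<in> gen_words"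
    by (auto simp: gen_elems_def gen_words_def Dgen_def)
  then show ?case
    by (blast intro: comm.base)
next
  case (brak x d y e)
  then obtain f g where "(f, d) \<in> comm mprod gen_words" "proj M f = x"
    "(g, e) \<in> comm mprod gen_words" "proj M g = y"
    by blast
  then show ?case
    by (intro exI[of _ "mprod f g"]) (simp add: comm.brak proj_mprod comm_gen_words(1))
qed

text \<open>A word is an iterated product of its letters, and each letter is a generator up to a
  scalar; the scalars come from the leaves \<open>Gen0\<close>, since \<open>Dword P 0 0\<close> is
  \<open>alpha0 P\<close> times that letter.\<close>

lemma word_scalar_multiple_comm:
  assumes "set_magma t \<subseteq> gens P X"
  shows "\<exists>c f d. word t = msc c f \<and> (f, d) \<in> comm mprod gen_words"
  using assms
proof (induction t)
  case (Leaf g)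
  then consider "g = Gen0" | \<iota> n where "g = Gen \<iota> n" "\<iota> \<in> X" "n < N0 P"
    by (auto simp: gens_def)
  then show ?case
  proof cases
    case 1
    have "word (Leaf g) = msc (inverse (alpha0 P)) (Dword P 0 0)"
      using 1 alpha0_nonzero by (simp add: word_Leaf Dword_def)
    moreover have "(Dword P 0 0, deg 0) \<in> gen_words"
      using N0_pos by (auto simp: gen_words_def)
    ultimately show ?thesis
      by (blast intro: comm.base)
  next
    case 2
    then have "word (Leaf g) = msc 1 (Dword P \<iota> n)"
      using zero_notin by (auto simp: word_Leaf Dword_def)
    moreover have "(Dword P \<iota> n, deg \<iota>) \<in> gen_words"
      using 2 by (auto simp: gen_words_def)
    ultimately show ?thesis
      by (blast intro: comm.base)
  qed
next
  case (Node u v)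
  then obtain c f d c' f' d' where "word u = msc c f" "(f, d) \<in> comm mprod gen_words"
    "word v = msc c' f'" "(f', d') \<in> comm mprod gen_words"
    by (metis Un_subset_iff magma.set(2))
  then have "word (Node u v) = msc (c * c') (mprod f f')"
    and "(mprod f f', d + d') \<in> comm mprod gen_words"
    by (simp_all add: word_Node mprod_msc_left mprod_msc_right comm.brak mult.commute)
  then show ?case
    by blast
qed

text \<open>Membership in \<open>words\<close> is carried through the induction because
  \<open>proj\<close> is known to be linear only there.\<close>

lemma proj_span:
  assumes "f \<in> msc.span S" and "S \<subseteq> words" and "\<And>s. s \<in> S \<Longrightarrow> proj M s \<in> span T"
  shows "f \<in> words \<and> proj M f \<in> span T"
  using assms(1)
proof (induction rule: msc.span_induct_alt)
  case base
  show ?case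
    by (simp only: proj_zero span_zero zero_in_free_words simp_thms)
next
  case (step c s g)
  have s: "msc c s \<in> words" "proj M (msc c s) \<in> span T"
    using step(1) assms(2,3) by (auto simp: proj_msc msc_in_free_words span_scale)
  show ?case
    using step(2) s by (metis add_in_free_words proj_add span_add)
qed

lemma span_comm_UNIV: "span (fst ` comm (brk M) gen_elems) = UNIV"
proof -
  have "x \<in> span (fst ` comm (brk M) gen_elems)" for x
  proof -
    obtain f where f: "f \<in> words" "proj M f = x"
      using proj_surj by blast
    let ?S = "{word t | t. set_magma t \<subseteq> gens P X} :: 'k words set"
    have "s \<in> words \<and> proj M s \<in> span (fst ` comm (brk M) gen_elems)" if s: "s \<in> ?S" for s
    proof -
      obtain c g d where g: "s = msc c g" "(g, d) \<in> comm mprod gen_words"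
        using s word_scalar_multiple_comm by blast
      have "proj M g \<in> fst ` comm (brk M) gen_elems"
        using comm_gen_words(2)[OF g(2)] by force
      then show ?thesis
        using g(1) comm_gen_words(1)[OF g(2)]
        by (simp add: proj_msc msc_in_free_words span_scale span_base)
    qed
    then show ?thesis
      using proj_span[of f ?S] free_words_subset_span f by blast
  qed
  then show ?thesis
    by blast
qed

text \<open>The \<open>N0\<close>-th iterate is linear, because \<open>c ^ card UNIV = c\<close> for
  scalars, and it fixes the spanning set of commutators.\<close>

lemma frob_period: "(frob M ^^ N0 P) x = x"
proof -
  have "x \<in> span (fst ` comm (brk M) gen_elems)"
    by (simp add: span_comm_UNIV)
  then show ?thesis
  proof (induction rule: span_induct_alt)
    case base
    then show ?case
      by (simp add: funpow_frob_zero)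
  next
    case (step c s y)
    then have "(frob M ^^ N0 P) s = s"
      using comm_frob_period by force
    moreover have "c ^ (chr P ^ N0 P) = c"
      using power_card_UNIV[of c] by (simp only: card_UNIV)
    ultimately show ?case
      using step by (simp add: funpow_frob_add funpow_frob_scl)
  qed
qed

text \<open>A projection onto the \<sigma>-invariants: the trace for the cyclic action of \<sigma>,
  twisted by an element of trace 1 so that invariants are fixed even when \<open>p\<close> divides
  \<open>N0\<close>.\<close>

definition "frob_trace x = (\<Sum>n<N0 P. (frob M ^^ n) (scl M (alpha0 P) x))"

lemma frob_trace_in_Fp_form: "frob_trace x \<in> Fp_form M"
proof -
  let ?h = "\<lambda>n. (frob M ^^ n) (scl M (alpha0 P) x)"
  \<comment> \<open>Applying Frobenius shifts the summands by one, so the difference telescopes and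
    vanishes by periodicity.\<close>
  have "frob M (frob_trace x) - frob_trace x = (\<Sum>n<N0 P. ?h (Suc n) - ?h n)"
    by (simp add: frob_trace_def frob_sum sum_subtractf)
  also have "\<dots> = ?h (N0 P) - ?h 0"
    by (rule sum_lessThan_telescope)
  also have "\<dots> = 0"
    by (simp add: frob_period)
  finally show ?thesis
    by (simp add: Fp_form_def)
qed

lemma frob_trace_Fp_form:
  assumes "x \<in> Fp_form M"
  shows "frob_trace x = x"
proof -
  have "(frob M ^^ n) x = x" for n
    using assms by (induction n) (simp_all add: Fp_form_def)
  then have "frob_trace x = scl M (\<Sum>n<N0 P. alpha0 P ^ (chr P ^ n)) x"
    by (simp add: frob_trace_def funpow_frob_scl scale_sum_left)
  then show ?thesis
    by (simp add: trace_alpha0)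
qed

lemma frob_trace_add: "frob_trace (x + y) = frob_trace x + frob_trace y"
  by (simp add: frob_trace_def scale_right_distrib funpow_frob_add sum.distrib)

lemma frob_trace_in_span:
  assumes "x \<in> span S" and "\<And>s. s \<in> S \<Longrightarrow> frob M s \<in> S"
  shows "frob_trace x \<in> span S"
proof -
  have "(frob M ^^ n) (scl M (alpha0 P) x) \<in> span S" for n
    by (induction n) (use assms in \<open>auto intro: span_scale span_frob\<close>)
  then show ?thesis
    unfolding frob_trace_def by (rule span_sum)
qed

text \<open>The splitting by degree exists over the large field because commutators span. The trace
  fixes \<open>x\<close> and preserves both Frobenius-stable spans, so it moves the two pieces into
  the \<open>Fp_form\<close>.\<close>

lemma Fp_form_decomposition:
  assumes "x \<in> Fp_form M"
  obtains y z where "x = y + z"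
    and "y \<in> Fp_form M" and "y \<in> span (comm_eq (brk M) gen_elems 0)"
    and "z \<in> Fp_form M" and "z \<in> span (comm_ge (brk M) gen_elems 1)"
proof -
  let ?S0 = "comm_eq (brk M) gen_elems 0" and ?S1 = "comm_ge (brk M) gen_elems 1"
  have "fst ` comm (brk M) gen_elems \<subseteq> ?S0 \<union> ?S1"
  proof (rule image_subsetI)
    fix w
    assume "w \<in> comm (brk M) gen_elems"
    then show "fst w \<in> ?S0 \<union> ?S1"
      unfolding comm_eq_def comm_ge_def by (cases w; cases "snd w = 0") (auto simp: Suc_le_eq)
  qed
  then have "x \<in> span (?S0 \<union> ?S1)"
    using span_mono span_comm_UNIV by blast
  then obtain y z where yz: "x = y + z" "y \<in> span ?S0" "z \<in> span ?S1"
    by (auto simp: span_Un)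
  have "x = frob_trace y + frob_trace z"
    using frob_trace_Fp_form[OF assms] yz(1) by (simp add: frob_trace_add)
  moreover have "frob M s \<in> ?S0" if "s \<in> ?S0" for s
    using that comm_frob unfolding comm_eq_def by simp
  then have "frob_trace y \<in> span ?S0"
    using yz(2) by (rule frob_trace_in_span[rotated])
  moreover have "frob M s \<in> ?S1" if "s \<in> ?S1" for s
    using that comm_frob unfolding comm_ge_def by blast
  then have "frob_trace z \<in> span ?S1"
    using yz(3) by (rule frob_trace_in_span[rotated])
  ultimately show thesis
    using that frob_trace_in_Fp_form by blast
qed

text \<open>The graded parts of the algebra are defined as images of spans of words, so an element
  spanned by commutators in the algebra must be lifted to that form.\<close>

lemma span_comm_eq_subset_proj:
  "span (comm_eq (brk M) gen_elems d) \<subseteq> proj M ` msc.span (comm_eq mprod gen_words d)"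
proof
  fix x
  assume "x \<in> span (comm_eq (brk M) gen_elems d)"
  then have "\<exists>f \<in> words \<inter> msc.span (comm_eq mprod gen_words d). proj M f = x"
  proof (induction rule: span_induct_alt)
    case base
    show ?case
      by (intro bexI[of _ 0] IntI proj_zero zero_in_free_words msc.span_zero)
  next
    case (step c s y)
    then obtain f where f: "f \<in> words" "f \<in> msc.span (comm_eq mprod gen_words d)" "proj M f = y"
      by blast
    obtain g where g: "(g, d) \<in> comm mprod gen_words" "proj M g = s"
      using step(1) comm_gen_elems_lift by (auto simp: comm_eq_def)
    have "msc c g + f \<in> msc.span (comm_eq mprod gen_words d)"
      using f(2) g(1)
      by (intro msc.span_add[OF msc.span_scale[OF msc.span_base] f(2)]) (simp add: comm_eq_def)
    moreover have "msc c g + f \<in> words" and "proj M (msc c g + f) = scl M c s + y"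
      using f g comm_gen_words(1)[OF g(1)]
      by (simp_all only: add_in_free_words msc_in_free_words proj_add proj_msc)
    ultimately show ?case
      by blast
  qed
  then show "x \<in> proj M ` msc.span (comm_eq mprod gen_words d)"
    by blast
qed

end


section \<open>The degree-lowering derivation\<close>

text \<open>A commutator of positive total degree contains a factor of positive degree.
  \<open>Vk\<close> kills that factor, hence every bracket built around it.\<close>

lemma base_change_span_comm_ge_eq_0:
  assumes "base_change M L V Vk" and "vector_space (scl M)"
    and "\<And>y. brk L 0 y = 0" and "\<And>x. brk L x 0 = 0"
    and "\<And>x d. (x, d) \<in> W \<Longrightarrow> 1 \<le> d \<Longrightarrow> Vk x = 0"
    and "z \<in> module.span (scl M) (comm_ge (brk M) W 1)"
  shows "Vk z = 0"
proof -
  interpret vector_space "scl M" by fact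
  have lin: "Vector_Spaces.linear (scl M) (scl L) Vk"
    and brk: "\<And>x y. Vk (brk M x y) = brk L (Vk x) (Vk y)"
    using assms(1) by (auto simp: base_change_def)
  interpret Vk: Vector_Spaces.linear "scl M" "scl L" Vk
    by (rule lin)
  have "1 \<le> d \<longrightarrow> Vk x = 0" if "(x, d) \<in> comm (brk M) W" for x d
    using that
  proof (induction rule: comm.induct)
    case (brak x d y e)
    then show ?case
      using assms(3,4) brk by (cases "1 \<le> d") auto
  qed (use assms(5) in blast)
  then have comm_0: "Vk x = 0" if "x \<in> comm_ge (brk M) W 1" for x
    using that by (auto simp: comm_ge_def)
  show ?thesis
    using assms(6)
    by (induction rule: span_induct_alt) (simp_all add: Vk.add Vk.scale Vk.zero comm_0)
qed

lemma Fp_form_eq_gr_0_plus_kernel: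
  assumes "admissible P" and "is_Ldag_bar P Ld" and "is_Lbar P L" and "is_V P Ld L V"
    and "x \<in> Fp_form Ld"
  obtains y z where "x = y + z" and "y \<in> gr P Ld 0" and "z \<in> Fp_form Ld" and "V z = 0"
proof -
  interpret Ld: graded_presentation P "Aplus P" "Ldag_bar_kernel P" Ld "ch P"
    using assms(1,2)
    by unfold_locales (auto simp: is_Ldag_bar_def Ldag_words_def admissible_def Aplus_def)
  obtain Vk where base: "base_change Ld L V Vk"
    and Vk0: "\<forall>\<iota>\<in>A0p P. \<forall>n<N0 P. 1 \<le> ch P \<iota> \<longrightarrow> Vk (Dgen P Ld \<iota> n) = 0"
    using assms(4) unfolding is_V_def by blast
  have "0 \<in> Lbar_words P"
    by (simp add: Lbar_words_def free_words_hat_def)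
  then have brk0: "brk L 0 y = 0" "brk L y 0 = 0" for y
    using presented_brk_zero assms(3) unfolding is_Lbar_def by blast+
  obtain y z where yz: "x = y + z"
    "y \<in> Fp_form Ld" "y \<in> Ld.span (comm_eq (brk Ld) Ld.gen_elems 0)"
    "z \<in> Fp_form Ld" "z \<in> Ld.span (comm_ge (brk Ld) Ld.gen_elems 1)"
    using Ld.Fp_form_decomposition[OF assms(5)] by blast
  have "Vk z = 0"
  proof (rule base_change_span_comm_ge_eq_0[OF base Ld.vector_space_axioms brk0])
    \<comment> \<open>The degree is \<open>ch\<close>, so a generator of positive degree is one of
      those that the definition of \<open>V\<close> sends to 0.\<close>
    show "Vk x = 0" if "(x, d) \<in> Ld.gen_elems" "1 \<le> d" for x d
      using that Vk0 by (auto simp: Ld.gen_elems_def A0p_def)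
  qed (rule yz(5))
  then have "V z = 0"
    using base yz(4) by (simp add: base_change_def)
  moreover have "y \<in> gr P Ld 0"
  proof -
    have "Ld.gen_words = {(Dword P \<iota> n, ch P \<iota>) | \<iota> n. \<iota> \<in> A0p P \<and> n < N0 P}"
      by (simp add: Ld.gen_words_def A0p_def)
    then have "msc.span (comm_eq mprod Ld.gen_words 0) \<subseteq> Ldag_gr P 0"
      unfolding Ldag_gr_def by (metis Un_upper2 msc.span_mono)
    then have "y \<in> gr_k P Ld 0"
      using yz(3) Ld.span_comm_eq_subset_proj unfolding gr_k_def by blast
    then show ?thesis
      using yz(2) by (simp add: gr_def)
  qed
  ultimately show thesis
    using that yz by blast
qed

section \<open>Additive maps and subgroups over the prime field\<close>

lemma Fp_lie_hom_zero:
  assumes "Fp_lie_hom M L V" and "0 \<in> Fp_form M"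
  shows "V 0 = 0"
  using assms unfolding Fp_lie_hom_def by (metis add_cancel_right_right)

lemma Fp_lie_hom_diff:
  assumes "Fp_lie_hom M L V" and "x \<in> Fp_form M" and "y \<in> Fp_form M" and "x - y \<in> Fp_form M"
  shows "V (x - y) = V x - V y"
proof -
  have "V x = V ((x - y) + y)"
    by simp
  also have "\<dots> = V (x - y) + V y"
    using assms unfolding Fp_lie_hom_def by blast
  finally show ?thesis
    by simp
qed

text \<open>A subgroup serves as a subspace over the prime field: scaling by the image of a natural
  number is repeated addition.\<close>

locale additive_set =
  fixes U :: "'a::ab_group_add set"
  assumes zero: "0 \<in> U" and diff: "x \<in> U \<Longrightarrow> y \<in> U \<Longrightarrow> x - y \<in> U"
begin

lemma minus: "x \<in> U \<Longrightarrow> - x \<in> U"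
  using diff[OF zero] by simp

lemma add: "x \<in> U \<Longrightarrow> y \<in> U \<Longrightarrow> x + y \<in> U"
  using diff[OF _ minus, of x y] by simp

lemma sum: "(\<And>i. i \<in> T \<Longrightarrow> h i \<in> U) \<Longrightarrow> (\<Sum>i\<in>T. h i) \<in> U"
  by (induction T rule: infinite_finite_induct) (auto simp: zero add)

lemma scale_of_nat:
  assumes "vector_space (sc :: 'k::field \<Rightarrow> _)" and "x \<in> U"
  shows "sc (of_nat n) x \<in> U"
proof -
  interpret vector_space sc by fact
  show ?thesis
    by (induction n) (simp_all add: zero scale_left_distrib add assms(2))
qed

end

text \<open>After exchanging the sums, the coefficient of \<open>(B ^^ i) x\<close> is a power sum
  of exponent \<open>p - 2 + i\<close> divided by \<open>i!\<close>; it is -1 for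
  \<open>i = 1\<close> and 0 otherwise.\<close>

lemma trunc_exp_coefficient_1:
  fixes P :: "'k::field params"
  assumes "prime (chr P)" and "CHAR('k) = chr P" and "vector_space (scl M)"
  shows "(\<Sum>\<gamma><chr P. scl M (of_nat (\<gamma> ^ (chr P - 2))) (trunc_exp P M \<gamma> B x)) = - B x"
proof -
  interpret vector_space "scl M" by fact
  let ?p = "chr P"
  let ?c = "\<lambda>i. (\<Sum>\<gamma><?p. (of_nat \<gamma> :: 'k) ^ (?p - 2 + i)) / of_nat (fact i)"
  have "(\<Sum>\<gamma><?p. scl M (of_nat (\<gamma> ^ (?p - 2))) (trunc_exp P M \<gamma> B x)) =
      (\<Sum>\<gamma><?p. \<Sum>i<?p. scl M (of_nat \<gamma> ^ (?p - 2 + i) / of_nat (fact i)) ((B ^^ i) x))"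
    by (simp add: trunc_exp_def scale_sum_right power_add)
  also have "\<dots> = (\<Sum>i<?p. scl M (?c i) ((B ^^ i) x))"
    by (subst sum.swap) (simp add: scale_sum_left sum_divide_distrib)
  also have "\<dots> = (\<Sum>i<?p. if i = 1 then - B x else 0)"
  proof (rule sum.cong[OF refl])
    fix i
    assume "i \<in> {..<?p}"
    then have "(\<Sum>\<gamma><?p. (of_nat \<gamma> :: 'k) ^ (?p - 2 + i)) = (if i = 1 then - 1 else 0)"
      using sum_powers_prime_field_shifted[where 'k = 'k, of i] assms(1,2) by simp
    then show "scl M (?c i) ((B ^^ i) x) = (if i = 1 then - B x else 0)"
      by simp
  qed
  also have "\<dots> = - B x"
    using prime_gt_1_nat[OF assms(1)] by simp
  finally show ?thesis .
qed

theorem proposition2p14: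
  fixes P :: "'k::{field,finite} params"
    and Ld :: "('k, 'l::ab_group_add) lie_form"
    and L :: "('k, 'm::ab_group_add) lie_form"
    and e :: "'l fls"
    and A :: "nat \<Rightarrow> 'l \<Rightarrow> 'l"
    and B :: "'l \<Rightarrow> 'l"
    and V :: "'l \<Rightarrow> 'm"
    and I :: "'m set"
  assumes "admissible P"
    and "is_Ldag_bar P Ld"
    and "is_Lbar P L"
    and "is_esp P Ld e"
    and "\<And>\<gamma>. \<gamma> < chr P \<Longrightarrow> is_Adag P Ld e \<gamma> (A \<gamma>)"
    and "is_Bdag P Ld A B"
    and "is_V P Ld L V"
    and "Fp_ideal L I"
  shows "(\<forall>\<gamma><chr P. A \<gamma> ` {x \<in> Fp_form Ld. V x = 0} \<subseteq> {x \<in> Fp_form Ld. V x \<in> I}) \<longleftrightarrow>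
         B ` {x \<in> Fp_form Ld. V x = 0} \<subseteq> {x \<in> Fp_form Ld. V x \<in> I}"
proof -
  let ?N = "{x \<in> Fp_form Ld. V x = 0}" and ?U = "{x \<in> Fp_form Ld. V x \<in> I}"
  have prime: "prime (chr P)" and CHAR: "CHAR('k) = chr P"
    using assms(1) CHAR_eq_if_card_eq_prime_power by (auto simp: admissible_def)
  have frob_add: "frob Ld (x + y) = frob Ld x + frob Ld y" for x y
    using assms(2) by (simp add: is_Ldag_bar_def presented_def)
  interpret Ld: vector_space "scl Ld"
    using assms(2) by (simp add: is_Ldag_bar_def presented_def)
  have B: "B x \<in> Fp_form Ld" "B (x + y) = B x + B y" if "x \<in> Fp_form Ld" "y \<in> Fp_form Ld" for x y
    using assms(6) that by (auto simp: is_Bdag_def Fp_derivation_def)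
  have "B ` gr P Ld 0 \<subseteq> sum_below (gr P Ld) 0"
    using assms(6) by (simp add: is_Bdag_def)
  \<comment> \<open>There is no degree below 0: \<open>sum_below\<close> at 0 contains only the
    empty sum.\<close>
  then have B_gr_0: "B y = 0" if "y \<in> gr P Ld 0" for y
    using that by (auto simp: sum_below_def)
  have A: "A \<gamma> x = trunc_exp P Ld \<gamma> B x" if "\<gamma> < chr P" "x \<in> Fp_form Ld" for \<gamma> x
    using assms(6) that by (simp add: is_Bdag_def)
  have V_hom: "Fp_lie_hom Ld L V"
    using assms(7) by (simp add: is_V_def)
  have I: "0 \<in> I" "\<And>x y. x \<in> I \<Longrightarrow> y \<in> I \<Longrightarrow> x - y \<in> I"
    using assms(8) by (auto simp: Fp_ideal_def)
  have Fp_zero: "0 \<in> Fp_form Ld"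
    using frob_add[of 0 0] by (simp add: Fp_form_def)
  have Fp_diff: "x - y \<in> Fp_form Ld" if "x \<in> Fp_form Ld" "y \<in> Fp_form Ld" for x y
    using frob_add[of "x - y" y] that by (simp add: Fp_form_def eq_diff_eq)
  interpret U: additive_set ?U
    using Fp_zero Fp_diff I Fp_lie_hom_zero[OF V_hom] Fp_lie_hom_diff[OF V_hom]
    by unfold_locales auto
  show ?thesis
  proof
    assume a: "\<forall>\<gamma><chr P. A \<gamma> ` ?N \<subseteq> ?U"
    show "B ` ?N \<subseteq> ?U"
    proof (rule image_subsetI)
      fix x
      assume x: "x \<in> ?N"
      have "trunc_exp P Ld \<gamma> B x \<in> ?U" if "\<gamma> < chr P" for \<gamma>
        using a that x A by auto
      \<comment> \<open>The weights are images of natural numbers, so the subgroup \<open>?U\<close>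
        is closed under this combination, whose value is \<open>- B x\<close>.\<close>
      then have "(\<Sum>\<gamma><chr P. scl Ld (of_nat (\<gamma> ^ (chr P - 2))) (trunc_exp P Ld \<gamma> B x)) \<in> ?U"
        by (intro U.sum U.scale_of_nat[OF Ld.vector_space_axioms]) simp
      then have "- B x \<in> ?U"
        by (simp only: trunc_exp_coefficient_1[OF prime CHAR Ld.vector_space_axioms])
      then show "B x \<in> ?U"
        using U.minus by fastforce
    qed
  next
    assume b: "B ` ?N \<subseteq> ?U"
    have B_U: "B x \<in> ?U" if x: "x \<in> Fp_form Ld" for x
    proof -
      obtain y z where yz: "x = y + z" "y \<in> gr P Ld 0" "z \<in> Fp_form Ld" "V z = 0"
        using Fp_form_eq_gr_0_plus_kernel[OF assms(1-3,7) x] .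
      then have "B x = B z"
        using B(2)[of y z] B_gr_0 by (simp add: gr_def)
      then show ?thesis
        using b yz(3,4) by auto
    qed
    \<comment> \<open>The start holds because \<open>V x = 0\<close> lies in \<open>I\<close>. Later
      iterates may leave the kernel of \<open>V\<close>, so the induction relies on
      \<open>B_U\<close> for arbitrary elements of \<open>Fp_form Ld\<close>.\<close>
    have funpow_U: "(B ^^ i) x \<in> ?U" if "x \<in> ?N" for i x
    proof (induction i)
      case 0
      then show ?case
        using that I(1) by simp
    next
      case (Suc i)
      then show ?case
        using B_U by simp
    qed
    show "\<forall>\<gamma><chr P. A \<gamma> ` ?N \<subseteq> ?U"
    proof (intro allI impI image_subsetI)
      fix \<gamma> x
      assume \<gamma>: "\<gamma> < chr P" and x: "x \<in> ?N"
      have "scl Ld (of_nat \<gamma> ^ i / of_nat (fact i)) ((B ^^ i) x) \<in> ?U" for i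
      proof -
        \<comment> \<open>\<open>?U\<close> is a subgroup and need not be stable under the whole
          field, so the coefficient is rewritten as a natural multiple of 1.\<close>
        obtain j where "(of_nat (\<gamma> ^ i) / of_nat (fact i) :: 'k) = of_nat j"
          using of_nat_divide_of_nat_is_of_nat[where 'k = 'k] prime CHAR by metis
        then show ?thesis
          using U.scale_of_nat[OF Ld.vector_space_axioms funpow_U[OF x], of j i] by simp
      qed
      then have "trunc_exp P Ld \<gamma> B x \<in> ?U"
        unfolding trunc_exp_def by (intro U.sum)
      then show "A \<gamma> x \<in> ?U"
        using A \<gamma> x by simp
    qed
  qed
qed

end
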